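(* The parameterized problem $P_2$-packing (parameter $k$) admits a kernel with at most $7k$ vertices.
   Context: $P_2$-packing: given an undirected graph $G$ and an integer $k$, decide whether $G$ contains $k$ pairwise vertex-disjoint paths with three vertices and two edges ($P_2$'s). A kernel with at most $f(k)$ vertices is a polynomial-time algorithm that maps any instance $(G,k)$ to an equivalent instance $(G',k')$ (i.e., $(G,k)$ is a yes-instance iff $(G',k')$ is) with $k'\le k$ and $|V(G')|\le f(k)$. *)

theory Defs
  imports "HOL-Computational_Algebra.Polynomial"
begin

section \<open>Graphs and packings of paths on three vertices\<close>

type_synonym 'a graph = "'a set \<times> 'a set set"

abbreviation verts :: "'a graph \<Rightarrow> 'a set" where "verts G \<equiv> fst G"
abbreviation edges :: "'a graph \<Rightarrow> 'a set set" where "edges G \<equiv> snd G"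

definition finite_simple_graph :: "'a graph \<Rightarrow> bool" where
  "finite_simple_graph G \<longleftrightarrow>
     finite (verts G) \<and> (\<forall>e\<in>edges G. e \<subseteq> verts G \<and> card e = 2)"

text \<open>The paths are subgraphs, not necessarily induced. A triple lists the vertices in path
  order.\<close>

definition is_P2 :: "'a graph \<Rightarrow> 'a \<times> 'a \<times> 'a \<Rightarrow> bool" where
  "is_P2 G = (\<lambda>(u, v, w). {u, v, w} \<subseteq> verts G \<and> distinct [u, v, w] \<and>
                {u, v} \<in> edges G \<and> {v, w} \<in> edges G)"

definition P2_verts :: "'a \<times> 'a \<times> 'a \<Rightarrow> 'a set" where
  "P2_verts = (\<lambda>(u, v, w). {u, v, w})"

definition P2_packing :: "'a graph \<Rightarrow> nat \<Rightarrow> bool" where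
  "P2_packing G k \<longleftrightarrow>
     (\<exists>P. finite P \<and> card P = k \<and> (\<forall>p\<in>P. is_P2 G p) \<and>
          pairwise (\<lambda>p q. disjnt (P2_verts p) (P2_verts q)) P)"


section \<open>Computation model\<close>

text \<open>Algorithms are first-order recursive programs over binary trees (pure Lisp; compare the
  tree languages in N. D. Jones, Computability and Complexity from a Programming Perspective).
  A program is a list of function bodies; the body of a function refers to its arguments as
  \<open>Var 0\<close>, \<open>Var 1\<close>, and so on, and function 0 is the main function. In
  \<open>LetIn a b\<close> the value of \<open>a\<close> becomes \<open>Var 0\<close> in \<open>b\<close> and the other variables are shifted.\<close>

datatype tree = Leaf | Branch tree tree

fun left :: "tree \<Rightarrow> tree" where
  "left Leaf = Leaf"
| "left (Branch l r) = l"

fun right :: "tree \<Rightarrow> tree" where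
  "right Leaf = Leaf"
| "right (Branch l r) = r"

datatype expr =
    Var nat
  | Empty
  | Join expr expr
  | Left expr
  | Right expr
  | IfLeaf expr expr expr
  | LetIn expr expr
  | Call nat "expr list"

type_synonym program = "expr list"

text \<open>\<open>evaluates p \<rho> a v t\<close>: in the environment \<open>\<rho>\<close> the expression \<open>a\<close> has the value \<open>v\<close>, and
  computing it takes \<open>t\<close> elementary steps. There is no derivation if the computation diverges
  or refers to a missing variable or function.\<close>

inductive evaluates :: "program \<Rightarrow> tree list \<Rightarrow> expr \<Rightarrow> tree \<Rightarrow> nat \<Rightarrow> bool"
  and evaluates_list :: "program \<Rightarrow> tree list \<Rightarrow> expr list \<Rightarrow> tree list \<Rightarrow> nat \<Rightarrow> bool"
  for p :: program
where
  Var: "i < length \<rho> \<Longrightarrow> evaluates p \<rho> (Var i) (\<rho> ! i) 1"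
| Empty: "evaluates p \<rho> Empty Leaf 1"
| Join: "evaluates p \<rho> a v s \<Longrightarrow> evaluates p \<rho> b w t \<Longrightarrow>
    evaluates p \<rho> (Join a b) (Branch v w) (Suc (s + t))"
| Left: "evaluates p \<rho> a v s \<Longrightarrow> evaluates p \<rho> (Left a) (left v) (Suc s)"
| Right: "evaluates p \<rho> a v s \<Longrightarrow> evaluates p \<rho> (Right a) (right v) (Suc s)"
| IfLeaf_Leaf: "evaluates p \<rho> a Leaf s \<Longrightarrow> evaluates p \<rho> b v t \<Longrightarrow>
    evaluates p \<rho> (IfLeaf a b c) v (Suc (s + t))"
| IfLeaf_Branch: "evaluates p \<rho> a (Branch l r) s \<Longrightarrow> evaluates p \<rho> c v t \<Longrightarrow>
    evaluates p \<rho> (IfLeaf a b c) v (Suc (s + t))"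
| LetIn: "evaluates p \<rho> a v s \<Longrightarrow> evaluates p (v # \<rho>) b w t \<Longrightarrow>
    evaluates p \<rho> (LetIn a b) w (Suc (s + t))"
| Call: "f < length p \<Longrightarrow> evaluates_list p \<rho> as vs s \<Longrightarrow> evaluates p vs (p ! f) w t \<Longrightarrow>
    evaluates p \<rho> (Call f as) w (Suc (s + t))"
| Nil: "evaluates_list p \<rho> [] [] 0"
| Cons: "evaluates p \<rho> a v s \<Longrightarrow> evaluates_list p \<rho> as vs t \<Longrightarrow>
    evaluates_list p \<rho> (a # as) (v # vs) (s + t)"

inductive_cases evaluates_VarE: "evaluates p \<rho> (Var i) v t"
inductive_cases evaluates_EmptyE: "evaluates p \<rho> Empty v t"
inductive_cases evaluates_JoinE: "evaluates p \<rho> (Join a b) v t"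
inductive_cases evaluates_LeftE: "evaluates p \<rho> (Left a) v t"
inductive_cases evaluates_RightE: "evaluates p \<rho> (Right a) v t"
inductive_cases evaluates_IfLeafE: "evaluates p \<rho> (IfLeaf a b c) v t"
inductive_cases evaluates_LetInE: "evaluates p \<rho> (LetIn a b) v t"
inductive_cases evaluates_CallE: "evaluates p \<rho> (Call f as) v t"
inductive_cases evaluates_NilE: "evaluates_list p \<rho> [] vs t"
inductive_cases evaluates_ConsE: "evaluates_list p \<rho> (a # as) vs t"

lemma evaluates_deterministic:
  "evaluates p \<rho> a v t \<Longrightarrow> evaluates p \<rho> a v' t' \<Longrightarrow> v = v' \<and> t = t'"
  "evaluates_list p \<rho> as vs t \<Longrightarrow> evaluates_list p \<rho> as vs' t' \<Longrightarrow> vs = vs' \<and> t = t'"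
proof (induction arbitrary: v' t' and vs' t' rule: evaluates_evaluates_list.inducts)
  case Var then show ?case by (auto elim: evaluates_VarE)
next
  case Empty then show ?case by (auto elim: evaluates_EmptyE)
next
  case Join from Join.prems show ?case by (rule evaluates_JoinE) (use Join.IH in blast)
next
  case Left from Left.prems show ?case by (rule evaluates_LeftE) (use Left.IH in blast)
next
  case Right from Right.prems show ?case by (rule evaluates_RightE) (use Right.IH in blast)
next
  case IfLeaf_Leaf
  from IfLeaf_Leaf.prems show ?case
    by (rule evaluates_IfLeafE) (use IfLeaf_Leaf.IH in blast)+
next
  case IfLeaf_Branch
  from IfLeaf_Branch.prems show ?case
    by (rule evaluates_IfLeafE) (use IfLeaf_Branch.IH in blast)+
next
  case LetIn from LetIn.prems show ?case by (rule evaluates_LetInE) (use LetIn.IH in blast)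
next
  case Call from Call.prems show ?case by (rule evaluates_CallE) (use Call.IH in blast)
next
  case Nil then show ?case by (auto elim: evaluates_NilE)
next
  case Cons from Cons.prems show ?case by (rule evaluates_ConsE) (use Cons.IH in blast)
qed

definition runs :: "program \<Rightarrow> tree \<Rightarrow> tree \<Rightarrow> nat \<Rightarrow> bool" where
  "runs p x y t \<longleftrightarrow> evaluates p [x] (Call 0 [Var 0]) y t"

text \<open>The size of a tree is the number of its inner nodes. A step copies a reference, not a tree,
  so trees share subtrees, and \<open>t\<close> steps may describe a tree of size exponential in \<open>t\<close>. The size
  of the result is therefore added to the running time, as the cost of writing it out. With this
  convention the model is polynomially equivalent to Turing machines.\<close>

definition poly_time_on :: "tree set \<Rightarrow> program \<Rightarrow> bool" where
  "poly_time_on X p \<longleftrightarrow>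
     (\<exists>q :: nat poly. \<forall>x\<in>X. \<exists>y t. runs p x y t \<and> t + size y \<le> poly q (size x))"


section \<open>Encoding of instances\<close>

text \<open>Numbers are lists of binary digits, least significant first, without leading zeros; this
  holds for the names of the vertices as well as for the parameter.\<close>

fun nat_code :: "nat \<Rightarrow> tree" where
  "nat_code n = (if n = 0 then Leaf
     else Branch (if even n then Leaf else Branch Leaf Leaf) (nat_code (n div 2)))"

declare nat_code.simps [simp del]

fun list_code :: "('a \<Rightarrow> tree) \<Rightarrow> 'a list \<Rightarrow> tree" where
  "list_code c [] = Leaf"
| "list_code c (x # xs) = Branch (c x) (list_code c xs)"

definition edge_code :: "nat \<times> nat \<Rightarrow> tree" where
  "edge_code = (\<lambda>(u, v). Branch (nat_code u) (nat_code v))"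

text \<open>A tree encodes \<open>(G, k)\<close> if it consists of a list of the vertices, a list of the edges, and
  \<open>k\<close>, in any order of the vertices, the edges, and the two ends of an edge. Every vertex and every
  edge is listed exactly once.\<close>

definition encodes :: "tree \<Rightarrow> nat graph \<Rightarrow> nat \<Rightarrow> bool" where
  "encodes x G k \<longleftrightarrow>
     (\<exists>vs es. distinct vs \<and> set vs = verts G \<and>
        distinct (map (\<lambda>(u, v). {u, v}) es) \<and> (\<lambda>(u, v). {u, v}) ` set es = edges G \<and>
        x = Branch (list_code nat_code vs) (Branch (list_code edge_code es) (nat_code k)))"

lemma nat_code_inject: "nat_code m = nat_code n \<Longrightarrow> m = n"
proof (induction m arbitrary: n rule: less_induct)
  case (less m)
  show ?case
  proof (cases "m = 0 \<or> n = 0")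
    case True
    then show ?thesis
      using less.prems by (auto simp: nat_code.simps[of m] nat_code.simps[of n] split: if_splits)
  next
    case False
    then have "nat_code (m div 2) = nat_code (n div 2)" and par: "even m = even n"
      using less.prems by (auto simp: nat_code.simps[of m] nat_code.simps[of n] split: if_splits)
    moreover have "m div 2 < m" using False by simp
    ultimately have "m div 2 = n div 2" using less.IH by blast
    with par show ?thesis
      by (metis even_two_times_div_two odd_two_times_div_two_succ)
  qed
qed

lemma list_code_inject:
  "(\<And>x y. c x = c y \<Longrightarrow> x = y) \<Longrightarrow> list_code c xs = list_code c ys \<Longrightarrow> xs = ys"
proof (induction xs arbitrary: ys)
  case Nil then show ?case by (cases ys) auto
next
  case (Cons x xs) then show ?case by (cases ys) auto
qed

lemma edge_code_inject: "edge_code e = edge_code f \<Longrightarrow> e = f"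
  by (auto simp: edge_code_def nat_code_inject split: prod.splits)

lemma encodes_unique:
  assumes "encodes x G k" "encodes x G' k'"
  shows "G = G' \<and> k = k'"
proof -
  obtain vs es where 1: "set vs = verts G" "(\<lambda>(u, v). {u, v}) ` set es = edges G"
    "x = Branch (list_code nat_code vs) (Branch (list_code edge_code es) (nat_code k))"
    using assms(1) unfolding encodes_def by blast
  obtain vs' es' where 2: "set vs' = verts G'" "(\<lambda>(u, v). {u, v}) ` set es' = edges G'"
    "x = Branch (list_code nat_code vs') (Branch (list_code edge_code es') (nat_code k'))"
    using assms(2) unfolding encodes_def by blast
  have "vs = vs'" "es = es'"
    using 1(3) 2(3) list_code_inject[OF nat_code_inject] list_code_inject[OF edge_code_inject]
    by auto
  then show ?thesis using 1 2 nat_code_inject by (auto simp: prod_eq_iff)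
qed

lemma encodes_exists:
  assumes "finite_simple_graph G"
  shows "\<exists>x. encodes x G k"
proof -
  have fin: "finite (verts G)" and E: "\<forall>e\<in>edges G. e \<subseteq> verts G \<and> card e = 2"
    using assms unfolding finite_simple_graph_def by auto
  have "finite (edges G)"
    using fin E by (auto intro: finite_subset[of _ "Pow (verts G)"])
  then obtain el where el: "set el = edges G" "distinct el"
    using finite_distinct_list by blast
  have "\<forall>e. \<exists>a. e \<in> edges G \<longrightarrow> (case a of (u, v) \<Rightarrow> {u, v}) = e"
    using E by (auto simp: card_2_iff) metis
  then obtain a where a: "\<And>e. e \<in> edges G \<Longrightarrow> (case a e of (u, v) \<Rightarrow> {u, v}) = e"
    by metis
  then have m: "map (\<lambda>(u, v). {u, v}) (map a el) = el"
    using el(1) by (auto intro!: map_idI)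
  then have "(\<lambda>(u, v). {u, v}) ` set (map a el) = edges G"
    using el(1) by (metis list.set_map)
  then show ?thesis
    using m el(2) finite_distinct_list[OF fin] unfolding encodes_def by metis
qed

section \<open>Kernels\<close>

definition instance_codes :: "tree set" where
  "instance_codes = {x. \<exists>G k. finite_simple_graph G \<and> encodes x G k}"

definition is_kernel ::
    "(nat graph \<Rightarrow> nat \<Rightarrow> bool) \<Rightarrow> (nat \<Rightarrow> nat) \<Rightarrow> program \<Rightarrow> bool" where
  "is_kernel Q f p \<longleftrightarrow>
     poly_time_on instance_codes p \<and>
     (\<forall>G k x y t. finite_simple_graph G \<and> encodes x G k \<and> runs p x y t \<longrightarrow>
        (\<exists>G' k'. finite_simple_graph G' \<and> encodes y G' k' \<and>
           (Q G k \<longleftrightarrow> Q G' k') \<and> k' \<le> k \<and> card (verts G') \<le> f k))"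

definition admits_kernel :: "(nat graph \<Rightarrow> nat \<Rightarrow> bool) \<Rightarrow> (nat \<Rightarrow> nat) \<Rightarrow> bool" where
  "admits_kernel Q f \<longleftrightarrow> (\<exists>p. is_kernel Q f p)"

end

theory Submission
  imports Defs
begin

text \<open>Take a packing \<open>P\<close> that cannot be improved by replacing one path by at most two, where
  better means more paths or, for the same number of paths, more edges outside the packing. If \<open>P\<close>
  has at least \<open>k\<close> paths, the answer is yes. Otherwise the vertices outside \<open>P\<close> induce isolated
  vertices and isolated edges. Match the isolated edges to vertices of \<open>P\<close>, at most one to each,
  and the isolated vertices to vertices of \<open>P\<close>, at most two to each, by a maximum matching. What
  remains unmatched lies in a crown whose head is saturated by matched items, so it can be deleted
  without changing \<open>k\<close>. By local optimality a path of \<open>P\<close> receives at most one edge, and isolated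
  vertices at only one of its three vertices; hence at most \<open>3 + 2 + 2\<close> vertices remain for each
  path of \<open>P\<close>.

  For the running time, the functions on encoded types that are computable in polynomial time
  are closed under composition, pairing, case distinction and those folds whose accumulator stays
  polynomially bounded.\<close>


section \<open>Relocation of programs\<close>

text \<open>The capacities come from what a head vertex \<open>s\<close> of a crown must own to have
  a private path: two isolated vertices \<open>x\<close>, \<open>y\<close> give
  \<open>x - s - y\<close>, one edge \<open>ab\<close> gives \<open>s - a - b\<close>. The edge
  count in the order of packings serves the isolated vertices alone: if they hang on two different
  vertices of one path, the path can be rerouted through one of them so that the number of paths
  stays and one more edge lies outside.

  The crown is never computed. Every unmatched item is deleted, and the crown appears only in the
  proof. What the matching must supply is a set of occupied slots that contains every slot visible
  to an unmatched item or to an owner of a slot in the set. An auction yields such a set from a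
  price that does not occur, without a search for augmenting paths, and its step is a plain list
  operation; this matters because the program has to be built and timed in the tree language. Loops
  until stability become folds along lists longer than the potential can grow.\<close>

lemma poly_nat_mono: "m \<le> n \<Longrightarrow> poly (q :: nat poly) m \<le> poly q n"
  by (induction q) (auto intro: add_mono mult_mono)

text \<open>\<open>LetIn\<close> puts a new value in front of the environment, so expressions
  written for a single argument must still evaluate when older variables follow it.\<close>

lemma evaluates_weaken:
  "evaluates p \<rho> a v t \<Longrightarrow> evaluates p (\<rho> @ \<rho>') a v t"
  "evaluates_list p \<rho> as vs t \<Longrightarrow> evaluates_list p (\<rho> @ \<rho>') as vs t"
proof (induction rule: evaluates_evaluates_list.inducts)
  case (Var i \<rho>)
  then show ?case
    using evaluates_evaluates_list.Var[of i "\<rho> @ \<rho>'" p] by (simp add: nth_append)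
qed (auto simp del: One_nat_def intro: evaluates_evaluates_list.intros)

lemma evaluates_append_program:
  "evaluates p \<rho> a v t \<Longrightarrow> evaluates (p @ p') \<rho> a v t"
  "evaluates_list p \<rho> as vs t \<Longrightarrow> evaluates_list (p @ p') \<rho> as vs t"
proof (induction rule: evaluates_evaluates_list.inducts)
  case (Call f \<rho> as vs s w t)
  then show ?case
    using evaluates_evaluates_list.Call[of f "p @ p'" \<rho> as vs s w t] by (simp add: nth_append)
qed (auto simp del: One_nat_def intro: evaluates_evaluates_list.intros)

text \<open>Functions are addressed by position. Placed behind \<open>n\<close> other functions, a
  program keeps working once all its call targets are raised by \<open>n\<close>; this lets several
  programs share one list.\<close>

fun shift_calls :: "nat \<Rightarrow> expr \<Rightarrow> expr" where
  "shift_calls n (Var i) = Var i"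
| "shift_calls n Empty = Empty"
| "shift_calls n (Join a b) = Join (shift_calls n a) (shift_calls n b)"
| "shift_calls n (Left a) = Left (shift_calls n a)"
| "shift_calls n (Right a) = Right (shift_calls n a)"
| "shift_calls n (IfLeaf a b c) = IfLeaf (shift_calls n a) (shift_calls n b) (shift_calls n c)"
| "shift_calls n (LetIn a b) = LetIn (shift_calls n a) (shift_calls n b)"
| "shift_calls n (Call f as) = Call (n + f) (map (shift_calls n) as)"

lemma evaluates_shift_calls:
  "evaluates p \<rho> a v t \<Longrightarrow>
    evaluates (p' @ map (shift_calls (length p')) p) \<rho> (shift_calls (length p') a) v t"
  "evaluates_list p \<rho> as vs t \<Longrightarrow>
    evaluates_list (p' @ map (shift_calls (length p')) p) \<rho>
      (map (shift_calls (length p')) as) vs t"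
proof (induction rule: evaluates_evaluates_list.inducts)
  case (Call f \<rho> as vs s w t)
  then show ?case
    using evaluates_evaluates_list.Call[of "length p' + f" "p' @ map (shift_calls (length p')) p"
        \<rho> "map (shift_calls (length p')) as" vs s w t]
    by (simp add: nth_append)
qed (auto simp del: One_nat_def intro: evaluates_evaluates_list.intros)


section \<open>Polynomial time on encoded types\<close>

class coded =
  fixes code :: "'a \<Rightarrow> tree"
  assumes code_inject: "code x = code y \<Longrightarrow> x = y"

lemma code_eq_iff: "code x = code y \<longleftrightarrow> x = y"
  using code_inject by blast

instantiation bool :: coded
begin
definition code_bool :: "bool \<Rightarrow> tree" where
  "code_bool b = (if b then Branch Leaf Leaf else Leaf)"
instance by standard (auto simp: code_bool_def split: if_splits)
end

instantiation nat :: coded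
begin
definition code_nat :: "nat \<Rightarrow> tree" where "code_nat = nat_code"
instance by standard (auto simp: code_nat_def nat_code_inject)
end

instantiation prod :: (coded, coded) coded
begin
definition code_prod :: "'a \<times> 'b \<Rightarrow> tree" where
  "code_prod x = Branch (code (fst x)) (code (snd x))"
instance by standard (auto simp: code_prod_def prod_eq_iff code_eq_iff)
end

instantiation list :: (coded) coded
begin
definition code_list :: "'a list \<Rightarrow> tree" where "code_list = list_code code"
instance by standard (metis code_list_def code_inject list_code_inject)
end

lemma code_Nil [simp]: "code [] = Leaf"
  by (simp add: code_list_def)

lemma code_Cons [simp]: "code (x # xs) = Branch (code x) (code xs)"
  by (simp add: code_list_def)

lemma code_Pair [simp]: "code (x, y) = Branch (code x) (code y)"
  by (simp add: code_prod_def)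

lemma code_True [simp]: "code True = Branch Leaf Leaf"
  and code_False [simp]: "code False = Leaf"
  by (simp_all add: code_bool_def)

lemma size_code_append [simp]: "size (code (xs @ ys)) = size (code xs) + size (code ys)"
  by (induction xs) auto

lemma size_code_fst: "size (code (fst x)) \<le> size (code x)"
  and size_code_snd: "size (code (snd x)) \<le> size (code x)"
  by (simp_all add: code_prod_def)

lemma length_le_size_code: "length xs \<le> size (code xs)"
  by (induction xs) auto

lemma size_code_member: "x \<in> set xs \<Longrightarrow> size (code x) \<le> size (code xs)"
  by (induction xs) auto

lemma size_code_filter: "size (code (filter P xs)) \<le> size (code xs)"
  by (induction xs) auto

text \<open>\<open>p\<close> is a library and \<open>e\<close> an expression over it whose only
  variable is the input, so expressions over one library combine freely without competing for
  function 0. Output size is bounded along with time because the output becomes the input of the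
  next computation.\<close>

definition computes :: "program \<Rightarrow> expr \<Rightarrow> nat poly \<Rightarrow> ('a::coded \<Rightarrow> 'b::coded) \<Rightarrow> bool" where
  "computes p e q f \<longleftrightarrow> (\<forall>x. \<exists>t. evaluates p [code x] e (code (f x)) t \<and>
     t + size (code (f x)) \<le> poly q (size (code x)))"

definition poly_time :: "('a::coded \<Rightarrow> 'b::coded) \<Rightarrow> bool" where
  "poly_time f \<longleftrightarrow> (\<exists>p e q. computes p e q f)"

lemma poly_timeI: "(\<And>x. \<exists>t. evaluates p [code x] e (code (f x)) t \<and>
     t + size (code (f x)) \<le> poly q (size (code x))) \<Longrightarrow> poly_time f"
  unfolding poly_time_def computes_def by blast

lemma computesE:
  assumes "computes p e q f"
  obtains t where "evaluates p [code x] e (code (f x)) t"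
    "t + size (code (f x)) \<le> poly q (size (code x))"
  using assms unfolding computes_def by blast

lemma poly_time_size:
  assumes "poly_time f"
  obtains q :: "nat poly" where "\<And>x. size (code (f x)) \<le> poly q (size (code x))"
  using assms unfolding poly_time_def computes_def by (metis add_leD2)

lemma computes_append_program: "computes p e q f \<Longrightarrow> computes (p @ p') e q f"
  unfolding computes_def using evaluates_append_program(1) by metis

lemma computes_shift_calls: "computes p e q f \<Longrightarrow>
    computes (p' @ map (shift_calls (length p')) p) (shift_calls (length p') e) q f"
  unfolding computes_def using evaluates_shift_calls(1) by metis

lemma poly_time_prefix:
  assumes "poly_time f"
  obtains p e q where "computes (p' @ p) e q f"
  using assms computes_shift_calls unfolding poly_time_def by metis

lemma poly_time_common_program2:
  assumes "poly_time f" "poly_time g"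
  obtains p e q e' q' where "computes p e q f" "computes p e' q' g"
  using assms computes_append_program computes_shift_calls unfolding poly_time_def by metis

lemma poly_time_common_program3:
  assumes "poly_time f" "poly_time g" "poly_time h"
  obtains p e q e' q' e'' q'' where
    "computes p e q f" "computes p e' q' g" "computes p e'' q'' h"
proof -
  obtain p e q e' q' where 1: "computes p e q f" "computes p e' q' g"
    using poly_time_common_program2[OF assms(1,2)] by metis
  obtain p' e'' q'' where "computes (p @ p') e'' q'' h"
    using poly_time_prefix[OF assms(3)] by metis
  with that 1 computes_append_program show thesis by metis
qed

lemma poly_time_id: "poly_time (\<lambda>x. x)"
proof (rule poly_timeI)
  show "\<exists>t. evaluates [] [code x] (Var 0) (code x) t \<and> t + size (code x) \<le>
      poly [:1, 1:] (size (code x))" for x :: 'a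
    using evaluates_evaluates_list.Var[of 0 "[code x]" "[]"] by auto
qed

lemma poly_time_comp:
  assumes "poly_time f" "poly_time g"
  shows "poly_time (\<lambda>x. g (f x))"
proof -
  obtain p e q e' q' where c: "computes p e q f" "computes p e' q' g"
    by (rule poly_time_common_program2[OF assms])
  show ?thesis
  proof (rule poly_timeI)
    fix x
    obtain s where s: "evaluates p [code x] e (code (f x)) s"
      "s + size (code (f x)) \<le> poly q (size (code x))"
      using c(1) by (rule computesE)
    obtain t where t: "evaluates p [code (f x)] e' (code (g (f x))) t"
      "t + size (code (g (f x))) \<le> poly q' (size (code (f x)))"
      using c(2) by (rule computesE)
    have "evaluates p (code (f x) # [code x]) e' (code (g (f x))) t"
      using evaluates_weaken(1)[OF t(1), of "[code x]"] by simp
    then have "evaluates p [code x] (LetIn e e') (code (g (f x))) (Suc (s + t))"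
      by (rule evaluates_evaluates_list.LetIn[OF s(1)])
    moreover have "Suc (s + t) + size (code (g (f x))) \<le>
        poly (q + q' \<circ>\<^sub>p q + 1) (size (code x))"
      using s(2) t(2) poly_nat_mono[of "size (code (f x))" "poly q (size (code x))" q']
      by (simp add: poly_pcompose)
    ultimately show "\<exists>t. evaluates p [code x] (LetIn e e') (code (g (f x))) t \<and>
        t + size (code (g (f x))) \<le> poly (q + q' \<circ>\<^sub>p q + 1) (size (code x))"
      by blast
  qed
qed

lemma poly_time_Branch:
  assumes "poly_time f" "poly_time g" "\<And>x. code (h x) = Branch (code (f x)) (code (g x))"
  shows "poly_time h"
proof -
  obtain p e q e' q' where c: "computes p e q f" "computes p e' q' g"
    using poly_time_common_program2[OF assms(1,2)] by metis
  show ?thesis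
  proof (rule poly_timeI)
    fix x
    obtain s where s: "evaluates p [code x] e (code (f x)) s"
      "s + size (code (f x)) \<le> poly q (size (code x))"
      using c(1) by (rule computesE)
    obtain t where t: "evaluates p [code x] e' (code (g x)) t"
      "t + size (code (g x)) \<le> poly q' (size (code x))"
      using c(2) by (rule computesE)
    have "evaluates p [code x] (Join e e') (code (h x)) (Suc (s + t))"
      unfolding assms(3) by (rule evaluates_evaluates_list.Join[OF s(1) t(1)])
    moreover have "Suc (s + t) + size (code (h x)) \<le> poly (q + q' + 2) (size (code x))"
      using s(2) t(2) by (simp add: assms(3))
    ultimately show "\<exists>t. evaluates p [code x] (Join e e') (code (h x)) t \<and>
        t + size (code (h x)) \<le> poly (q + q' + 2) (size (code x))"
      by blast
  qed
qed

lemma poly_time_left: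
  assumes "poly_time f" "\<And>x. code (h x) = left (code (f x))"
  shows "poly_time h"
proof -
  obtain p e q where c: "computes p e q f"
    using assms(1) unfolding poly_time_def by metis
  show ?thesis
  proof (rule poly_timeI)
    fix x
    obtain s where s: "evaluates p [code x] e (code (f x)) s"
      "s + size (code (f x)) \<le> poly q (size (code x))"
      using c(1) by (rule computesE)
    have "evaluates p [code x] (Left e) (code (h x)) (Suc s)"
      unfolding assms(2) by (rule evaluates_evaluates_list.Left[OF s(1)])
    moreover have "size (code (h x)) \<le> size (code (f x))"
      unfolding assms(2) by (cases "code (f x)") auto
    with s(2) have "Suc s + size (code (h x)) \<le> poly (q + 1) (size (code x))"
      by simp
    ultimately show "\<exists>t. evaluates p [code x] (Left e) (code (h x)) t \<and>
        t + size (code (h x)) \<le> poly (q + 1) (size (code x))"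
      by blast
  qed
qed

lemma poly_time_right:
  assumes "poly_time f" "\<And>x. code (h x) = right (code (f x))"
  shows "poly_time h"
proof -
  obtain p e q where c: "computes p e q f"
    using assms(1) unfolding poly_time_def by metis
  show ?thesis
  proof (rule poly_timeI)
    fix x
    obtain s where s: "evaluates p [code x] e (code (f x)) s"
      "s + size (code (f x)) \<le> poly q (size (code x))"
      using c(1) by (rule computesE)
    have "evaluates p [code x] (Right e) (code (h x)) (Suc s)"
      unfolding assms(2) by (rule evaluates_evaluates_list.Right[OF s(1)])
    moreover have "size (code (h x)) \<le> size (code (f x))"
      unfolding assms(2) by (cases "code (f x)") auto
    with s(2) have "Suc s + size (code (h x)) \<le> poly (q + 1) (size (code x))"
      by simp
    ultimately show "\<exists>t. evaluates p [code x] (Right e) (code (h x)) t \<and>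
        t + size (code (h x)) \<le> poly (q + 1) (size (code x))"
      by blast
  qed
qed

fun tree_expr :: "tree \<Rightarrow> expr" where
  "tree_expr Leaf = Empty"
| "tree_expr (Branch l r) = Join (tree_expr l) (tree_expr r)"

lemma evaluates_tree_expr: "\<exists>t. evaluates p \<rho> (tree_expr v) v t"
  by (induction v) (auto intro: evaluates_evaluates_list.intros)

lemma poly_time_const: "poly_time (\<lambda>x. c)"
proof -
  obtain t where t: "evaluates [] [] (tree_expr (code c)) (code c) t"
    using evaluates_tree_expr by blast
  show ?thesis
  proof (rule poly_timeI)
    show "\<exists>t'. evaluates [] [code x] (tree_expr (code c)) (code c) t' \<and>
      t' + size (code c) \<le> poly [:t + size (code c):] (size (code x))" for x :: 'a
      using evaluates_weaken(1)[OF t, of "[code x]"] by auto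
  qed
qed

lemma poly_time_If:
  assumes "poly_time b" "poly_time f" "poly_time g"
  shows "poly_time (\<lambda>x. if b x then f x else g x)"
proof -
  obtain p e q e' q' e'' q'' where
    c: "computes p e q b" "computes p e' q' f" "computes p e'' q'' g"
    by (rule poly_time_common_program3[OF assms])
  show ?thesis
  proof (rule poly_timeI)
    fix x
    let ?h = "\<lambda>x. if b x then f x else g x"
    obtain r where r: "evaluates p [code x] e (code (b x)) r"
      "r + size (code (b x)) \<le> poly q (size (code x))"
      using c(1) by (rule computesE)
    obtain s where s: "evaluates p [code x] e' (code (f x)) s"
      "s + size (code (f x)) \<le> poly q' (size (code x))"
      using c(2) by (rule computesE)
    obtain t where t: "evaluates p [code x] e'' (code (g x)) t"
      "t + size (code (g x)) \<le> poly q'' (size (code x))"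
      using c(3) by (rule computesE)
    \<comment> \<open>\<open>False\<close> is coded by \<open>Leaf\<close>, so the leaf branch is
      \<open>e''\<close>, the one for \<open>g\<close>.\<close>
    show "\<exists>t. evaluates p [code x] (IfLeaf e e'' e') (code (?h x)) t \<and>
        t + size (code (?h x)) \<le> poly (q + q' + q'' + 1) (size (code x))"
    proof (cases "b x")
      case True
      then have "evaluates p [code x] (IfLeaf e e'' e') (code (?h x)) (Suc (r + s))"
        using r(1) s(1) by (auto intro: evaluates_evaluates_list.IfLeaf_Branch)
      moreover have "Suc (r + s) + size (code (?h x)) \<le>
          poly (q + q' + q'' + 1) (size (code x))"
        using True r(2) s(2) by simp
      ultimately show ?thesis by blast
    next
      case False
      then have "evaluates p [code x] (IfLeaf e e'' e') (code (?h x)) (Suc (r + t))"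
        using r(1) t(1) by (auto intro: evaluates_evaluates_list.IfLeaf_Leaf)
      moreover have "Suc (r + t) + size (code (?h x)) \<le>
          poly (q + q' + q'' + 1) (size (code x))"
        using False r(2) t(2) by simp
      ultimately show ?thesis by blast
    qed
  qed
qed

lemma poly_time_Pair: "poly_time f \<Longrightarrow> poly_time g \<Longrightarrow> poly_time (\<lambda>x. (f x, g x))"
  by (rule poly_time_Branch) auto

lemma poly_time_Cons: "poly_time f \<Longrightarrow> poly_time g \<Longrightarrow> poly_time (\<lambda>x. f x # g x)"
  by (rule poly_time_Branch) auto

lemma poly_time_fst: "poly_time f \<Longrightarrow> poly_time (\<lambda>x. fst (f x))"
  by (erule poly_time_left) (simp add: code_prod_def)

lemma poly_time_snd: "poly_time f \<Longrightarrow> poly_time (\<lambda>x. snd (f x))"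
  by (erule poly_time_right) (simp add: code_prod_def)

lemma poly_time_tl: "poly_time f \<Longrightarrow> poly_time (\<lambda>x. tl (f x))"
  by (erule poly_time_right) (metis code_Cons code_Nil list.collapse list.sel(2) right.simps)

lemma evaluates_Call_0: "evaluates_list (b # p) \<rho> as vs s \<Longrightarrow> evaluates (b # p) vs b w t \<Longrightarrow>
    evaluates (b # p) \<rho> (Call 0 as) w (Suc (s + t))"
  using evaluates_evaluates_list.Call[of 0 "b # p"] by simp

section \<open>Equality of trees and binary increment\<close>

definition eq_body :: expr where
  "eq_body = IfLeaf (Var 0) (IfLeaf (Var 1) (Join Empty Empty) Empty)
     (IfLeaf (Var 1) Empty
       (IfLeaf (Call 0 [Left (Var 0), Left (Var 1)]) Empty
          (Call 0 [Right (Var 0), Right (Var 1)])))"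

lemma evaluates_Var0: "evaluates p (v # \<rho>) (Var 0) v 1"
  and evaluates_Var1: "evaluates p (u # v # \<rho>) (Var 1) v 1"
  and evaluates_Var2: "evaluates p (u # w # v # \<rho>) (Var 2) v 1"
  using evaluates_evaluates_list.Var[of 0 "v # \<rho>" p]
    evaluates_evaluates_list.Var[of 1 "u # v # \<rho>" p]
    evaluates_evaluates_list.Var[of 2 "u # w # v # \<rho>" p]
  by simp_all

lemmas evaluates_Vars = evaluates_Var0 evaluates_Var1 evaluates_Var2

text \<open>\<open>2 * size u + 1\<close> counts the nodes of \<open>u\<close> including its leaves.
  Every call visits a new node of \<open>u\<close>, and 30 steps per node are ample.\<close>

lemma evaluates_eq_body:
  "\<exists>t. evaluates [eq_body] [u, v] eq_body (code (u = v)) t \<and> t \<le> 30 * Suc (2 * size u)"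
proof (induction u arbitrary: v)
  case Leaf
  show ?case
  proof (cases v)
    case Leaf
    have "evaluates [eq_body] [Leaf, Leaf] eq_body (Branch Leaf Leaf)
        (Suc (1 + Suc (1 + Suc (1 + 1))))"
      unfolding eq_body_def
      by (intro evaluates_evaluates_list.IfLeaf_Leaf evaluates_evaluates_list.Join
          evaluates_evaluates_list.Empty evaluates_Vars)
    with Leaf show ?thesis by force
  next
    case (Branch l r)
    have "evaluates [eq_body] [Leaf, Branch l r] eq_body Leaf (Suc (1 + Suc (1 + 1)))"
      unfolding eq_body_def
      by (rule evaluates_evaluates_list.IfLeaf_Leaf[OF _ evaluates_evaluates_list.IfLeaf_Branch]
          evaluates_evaluates_list.Empty evaluates_Vars)+
    with Branch show ?thesis by force
  qed
next
  case (Branch l r)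
  show ?case
  proof (cases v)
    case Leaf
    have "evaluates [eq_body] [Branch l r, Leaf] eq_body Leaf (Suc (1 + Suc (1 + 1)))"
      unfolding eq_body_def
      by (rule evaluates_evaluates_list.IfLeaf_Branch[OF _ evaluates_evaluates_list.IfLeaf_Leaf]
          evaluates_evaluates_list.Empty evaluates_Vars)+
    with Leaf show ?thesis by force
  next
    case v: (Branch l' r')
    let ?\<rho> = "[Branch l r, Branch l' r']"
    obtain s where s: "evaluates [eq_body] [l, l'] eq_body (code (l = l')) s"
      "s \<le> 30 * Suc (2 * size l)" using Branch.IH(1) by blast
    obtain t where t: "evaluates [eq_body] [r, r'] eq_body (code (r = r')) t"
      "t \<le> 30 * Suc (2 * size r)" using Branch.IH(2) by blast
    have "evaluates_list [eq_body] ?\<rho> [Left (Var 0), Left (Var 1)] [l, l'] 4"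
      using evaluates_evaluates_list.Cons[OF evaluates_evaluates_list.Left[OF evaluates_Var0]
          evaluates_evaluates_list.Cons[OF evaluates_evaluates_list.Left[OF evaluates_Var1]
          evaluates_evaluates_list.Nil], of "[eq_body]" "Branch l r" "Branch l' r'" "[]"]
      by (simp add: numeral_eq_Suc)
    then have cl: "evaluates [eq_body] ?\<rho> (Call 0 [Left (Var 0), Left (Var 1)])
        (code (l = l')) (Suc (4 + s))"
      by (rule evaluates_Call_0[OF _ s(1)])
    have "evaluates_list [eq_body] ?\<rho> [Right (Var 0), Right (Var 1)] [r, r'] 4"
      using evaluates_evaluates_list.Cons[OF evaluates_evaluates_list.Right[OF evaluates_Var0]
          evaluates_evaluates_list.Cons[OF evaluates_evaluates_list.Right[OF evaluates_Var1]
          evaluates_evaluates_list.Nil], of "[eq_body]" "Branch l r" "Branch l' r'" "[]"]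
      by (simp add: numeral_eq_Suc)
    then have cr: "evaluates [eq_body] ?\<rho> (Call 0 [Right (Var 0), Right (Var 1)])
        (code (r = r')) (Suc (4 + t))"
      by (rule evaluates_Call_0[OF _ t(1)])
    have "\<exists>t'. evaluates [eq_body] ?\<rho>
        (IfLeaf (Call 0 [Left (Var 0), Left (Var 1)]) Empty
          (Call 0 [Right (Var 0), Right (Var 1)])) (code (l = l' \<and> r = r')) t' \<and>
        t' \<le> s + t + 12"
    proof (cases "l = l'")
      case True
      with cl have "evaluates [eq_body] ?\<rho> (Call 0 [Left (Var 0), Left (Var 1)])
        (Branch Leaf Leaf) (Suc (4 + s))" by simp
      from evaluates_evaluates_list.IfLeaf_Branch[OF this cr] True show ?thesis by force
    next
      case False
      with cl have "evaluates [eq_body] ?\<rho> (Call 0 [Left (Var 0), Left (Var 1)])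
        Leaf (Suc (4 + s))" by simp
      from evaluates_evaluates_list.IfLeaf_Leaf[OF this evaluates_evaluates_list.Empty] False
      show ?thesis by force
    qed
    then obtain t' where t': "evaluates [eq_body] ?\<rho>
        (IfLeaf (Call 0 [Left (Var 0), Left (Var 1)]) Empty
          (Call 0 [Right (Var 0), Right (Var 1)])) (code (l = l' \<and> r = r')) t'"
        "t' \<le> s + t + 12" by blast
    have "evaluates [eq_body] ?\<rho> eq_body (code (l = l' \<and> r = r')) (Suc (1 + Suc (1 + t')))"
      by (subst (2) eq_body_def)
        (rule evaluates_evaluates_list.IfLeaf_Branch evaluates_Vars t'(1))+
    moreover have "Suc (1 + Suc (1 + t')) \<le> 30 * Suc (2 * size (Branch l r))"
      using t'(2) s(2) t(2) by simp
    ultimately show ?thesis unfolding v by auto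
  qed
qed

lemma poly_time_eq_Pair: "poly_time (\<lambda>x. fst x = snd x)"
proof (rule poly_timeI)
  fix x :: "'a \<times> 'a"
  let ?p = "[eq_body]"
  obtain t where t: "evaluates ?p [code (fst x), code (snd x)] eq_body (code (fst x = snd x)) t"
    "t \<le> 30 * Suc (2 * size (code (fst x)))"
    using evaluates_eq_body[of "code (fst x)" "code (snd x)"] by (auto simp: code_eq_iff)
  have "evaluates_list ?p [code x] [Left (Var 0), Right (Var 0)] [code (fst x), code (snd x)] 4"
    using evaluates_evaluates_list.Cons[OF evaluates_evaluates_list.Left[OF evaluates_Var0]
          evaluates_evaluates_list.Cons[OF evaluates_evaluates_list.Right[OF evaluates_Var0]
          evaluates_evaluates_list.Nil], of ?p "code x" "[]"]
    by (simp add: code_prod_def numeral_eq_Suc)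
  then have "evaluates ?p [code x] (Call 0 [Left (Var 0), Right (Var 0)])
      (code (fst x = snd x)) (Suc (4 + t))"
    by (rule evaluates_Call_0[OF _ t(1)])
  moreover have "Suc (4 + t) + size (code (fst x = snd x)) \<le> poly [:40, 60:] (size (code x))"
    using t(2) by (auto simp: code_prod_def code_bool_def)
  ultimately show "\<exists>t. evaluates ?p [code x] (Call 0 [Left (Var 0), Right (Var 0)])
      (code (fst x = snd x)) t \<and>
      t + size (code (fst x = snd x)) \<le> poly [:40, 60:] (size (code x))"
    by blast
qed

lemma poly_time_eq: "poly_time f \<Longrightarrow> poly_time g \<Longrightarrow> poly_time (\<lambda>x. f x = g x)"
  using poly_time_comp[OF poly_time_Pair poly_time_eq_Pair, of f g] by simp

text \<open>Increment with carry: digit 0 becomes 1 and ends the recursion, digit 1 becomes 0 and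
  passes the carry to the higher digits.\<close>

definition Suc_body :: expr where
  "Suc_body = IfLeaf (Var 0) (Join (Join Empty Empty) Empty)
     (IfLeaf (Left (Var 0)) (Join (Join Empty Empty) (Right (Var 0)))
       (Join Empty (Call 0 [Right (Var 0)])))"

lemma nat_code_0 [simp]: "nat_code 0 = Leaf"
  by (simp add: nat_code.simps)

lemma nat_code_double: "0 < n \<Longrightarrow> nat_code (2 * n) = Branch Leaf (nat_code n)"
  by (subst nat_code.simps) simp

lemma nat_code_Suc_double: "nat_code (Suc (2 * n)) = Branch (Branch Leaf Leaf) (nat_code n)"
  by (subst nat_code.simps) simp

lemma evaluates_Suc_body:
  "\<exists>t. evaluates [Suc_body] [nat_code n] Suc_body (nat_code (Suc n)) t \<and>
     t \<le> 30 * Suc (size (nat_code n)) \<and> size (nat_code (Suc n)) \<le> size (nat_code n) + 2"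
proof (induction n rule: less_induct)
  case (less n)
  consider "n = 0" | m where "n = 2 * m" "m > 0" | m where "n = Suc (2 * m)"
    by (metis bot_nat_0.not_eq_extremum evenE mult_0_right oddE Suc_eq_plus1)
  then show ?case
  proof cases
    case 1
    have "evaluates [Suc_body] [Leaf] Suc_body (Branch (Branch Leaf Leaf) Leaf)
        (Suc (1 + Suc (Suc (1 + 1) + 1)))"
      unfolding Suc_body_def
      by (intro evaluates_evaluates_list.IfLeaf_Leaf evaluates_evaluates_list.Join
          evaluates_evaluates_list.Empty evaluates_Vars)
    then show ?thesis using 1 nat_code_Suc_double[of 0] by force
  next
    case 2
    let ?v = "Branch Leaf (nat_code m)"
    have l: "evaluates [Suc_body] [?v] (Left (Var 0)) Leaf (Suc 1)"
      and r: "evaluates [Suc_body] [?v] (Right (Var 0)) (nat_code m) (Suc 1)"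
      using evaluates_evaluates_list.Left[OF evaluates_Var0, of "[Suc_body]" ?v "[]"]
        evaluates_evaluates_list.Right[OF evaluates_Var0, of "[Suc_body]" ?v "[]"] by simp_all
    have "evaluates [Suc_body] [?v] Suc_body (Branch (Branch Leaf Leaf) (nat_code m))
        (Suc (1 + Suc (Suc 1 + Suc (Suc (1 + 1) + Suc 1))))"
      by (subst (2) Suc_body_def)
        (intro evaluates_evaluates_list.IfLeaf_Branch[OF evaluates_Var0]
          evaluates_evaluates_list.IfLeaf_Leaf[OF l]
          evaluates_evaluates_list.Join evaluates_evaluates_list.Empty r)
    then show ?thesis using 2 nat_code_Suc_double[of m] nat_code_double[of m] by force
  next
    case 3
    let ?v = "Branch (Branch Leaf Leaf) (nat_code m)"
    obtain t where t: "evaluates [Suc_body] [nat_code m] Suc_body (nat_code (Suc m)) t"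
     "t \<le> 30 * Suc (size (nat_code m))" "size (nat_code (Suc m)) \<le> size (nat_code m) + 2"
      using less[of m] 3 by auto
    have l: "evaluates [Suc_body] [?v] (Left (Var 0)) (Branch Leaf Leaf) (Suc 1)"
      and r: "evaluates [Suc_body] [?v] (Right (Var 0)) (nat_code m) (Suc 1)"
      using evaluates_evaluates_list.Left[OF evaluates_Var0, of "[Suc_body]" ?v "[]"]
        evaluates_evaluates_list.Right[OF evaluates_Var0, of "[Suc_body]" ?v "[]"] by simp_all
    have "evaluates_list [Suc_body] [?v] [Right (Var 0)] [nat_code m] (Suc 1 + 0)"
      by (rule evaluates_evaluates_list.Cons[OF r evaluates_evaluates_list.Nil])
    then have c: "evaluates [Suc_body] [?v] (Call 0 [Right (Var 0)]) (nat_code (Suc m))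
        (Suc ((Suc 1 + 0) + t))"
      by (rule evaluates_Call_0[OF _ t(1)])
    have "evaluates [Suc_body] [?v] Suc_body (Branch Leaf (nat_code (Suc m)))
        (Suc (1 + Suc (Suc 1 + Suc (1 + Suc ((Suc 1 + 0) + t)))))"
      by (subst (2) Suc_body_def)
        (intro evaluates_evaluates_list.IfLeaf_Branch[OF evaluates_Var0]
          evaluates_evaluates_list.IfLeaf_Branch[OF l]
          evaluates_evaluates_list.Join evaluates_evaluates_list.Empty c)
    moreover have "nat_code (Suc n) = Branch Leaf (nat_code (Suc m))"
      using nat_code_double[of "Suc m"] 3 by simp
    ultimately show ?thesis using 3 t(2,3) by (force simp: nat_code_Suc_double)
  qed
qed

lemma size_code_Suc: "size (code (Suc n)) \<le> size (code n) + 2"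
  using evaluates_Suc_body[of n] by (auto simp: code_nat_def)

lemma poly_time_Suc:
  assumes "poly_time f"
  shows "poly_time (\<lambda>x. Suc (f x))"
proof -
  have "poly_time Suc"
  proof (rule poly_timeI)
    fix n
    let ?p = "[Suc_body]"
    obtain t where t: "evaluates ?p [code n] Suc_body (code (Suc n)) t"
      "t \<le> 30 * Suc (size (code n))"
      using evaluates_Suc_body[of n] by (auto simp: code_nat_def)
    have "t + size (code (Suc n)) \<le> poly [:40, 31:] (size (code n))"
      using t(2) size_code_Suc[of n] by simp
    with t show "\<exists>t. evaluates ?p [code n] Suc_body (code (Suc n)) t \<and>
      t + size (code (Suc n)) \<le> poly [:40, 31:] (size (code n))"
      by blast
  qed
  from poly_time_comp[OF assms this] show ?thesis .
qed


section \<open>Recursion along a list\<close>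

definition fold_body :: "expr \<Rightarrow> expr" where
  "fold_body e = IfLeaf (Var 1) (Var 2)
     (Call 0 [Var 0, Right (Var 1), LetIn (Join (Var 0) (Join (Left (Var 1)) (Var 2))) e])"

text \<open>The induction runs over the unread part \<open>zs\<close>, while the read part
  \<open>ys\<close> determines the accumulator. The bound \<open>K\<close> concerns only
  accumulators that really occur in this run; 20 and 5 cover the administration.\<close>

lemma evaluates_fold_body:
  fixes g :: "'x::coded \<Rightarrow> 'a::coded \<Rightarrow> 's::coded \<Rightarrow> 's"
  assumes step: "\<And>a ys zs. xs = ys @ a # zs \<Longrightarrow>
      \<exists>t\<le>K. evaluates (fold_body e # p) [code (x, a, fold (g x) ys s)] e
        (code (fold (g x) (ys @ [a]) s)) t"
    and "xs = ys @ zs"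
  shows "\<exists>t\<le>length zs * (K + 20) + 5. evaluates (fold_body e # p)
      [code x, code zs, code (fold (g x) ys s)] (fold_body e) (code (fold (g x) xs s)) t"
  using assms(2)
proof (induction zs arbitrary: ys)
  case Nil
  have "evaluates (fold_body e # p) [code x, Leaf, code (fold (g x) ys s)] (fold_body e)
      (code (fold (g x) ys s)) (Suc (1 + 1))"
    by (subst (2) fold_body_def)
      (rule evaluates_evaluates_list.IfLeaf_Leaf evaluates_Vars)+
  with Nil show ?case by (intro exI[of _ "Suc (1 + 1)"]) auto
next
  case (Cons a zs)
  let ?p = "fold_body e # p"
  let ?s = "code (fold (g x) ys s)" and ?s' = "code (fold (g x) (ys @ [a]) s)"
  let ?\<rho> = "[code x, code (a # zs), ?s]"
  obtain k where k: "k \<le> K" "evaluates ?p [code (x, a, fold (g x) ys s)] e ?s' k"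
    using step Cons.prems by blast
  obtain t where t: "t \<le> length zs * (K + 20) + 5"
    "evaluates ?p [code x, code zs, ?s'] (fold_body e) (code (fold (g x) xs s)) t"
    using Cons.IH[of "ys @ [a]"] Cons.prems by auto
  have "evaluates ?p ?\<rho> (Join (Var 0) (Join (Left (Var 1)) (Var 2)))
      (code (x, a, fold (g x) ys s)) (Suc (1 + Suc (Suc 1 + 1)))"
    unfolding code_Pair
    using evaluates_evaluates_list.Left[OF evaluates_Var1, of ?p "code x" "code (a # zs)" "[?s]"]
    by (intro evaluates_evaluates_list.Join evaluates_Vars) simp
  then have "evaluates ?p ?\<rho> (LetIn (Join (Var 0) (Join (Left (Var 1)) (Var 2))) e) ?s'
      (Suc (Suc (1 + Suc (Suc 1 + 1)) + k))"
    using evaluates_weaken(1)[OF k(2), of ?\<rho>]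
    by (intro evaluates_evaluates_list.LetIn) auto
  moreover have "evaluates ?p ?\<rho> (Right (Var 1)) (code zs) (Suc 1)"
    using evaluates_evaluates_list.Right[OF evaluates_Var1, of ?p "code x" "code (a # zs)" "[?s]"]
    by simp
  ultimately have "evaluates_list ?p ?\<rho>
      [Var 0, Right (Var 1), LetIn (Join (Var 0) (Join (Left (Var 1)) (Var 2))) e]
      [code x, code zs, ?s'] (1 + (Suc 1 + (Suc (Suc (1 + Suc (Suc 1 + 1)) + k) + 0)))"
    by (intro evaluates_evaluates_list.Cons evaluates_evaluates_list.Nil evaluates_Vars)
  from evaluates_Call_0[OF this t(2)]
  have c: "evaluates ?p ?\<rho> (Call 0
      [Var 0, Right (Var 1), LetIn (Join (Var 0) (Join (Left (Var 1)) (Var 2))) e])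
      (code (fold (g x) xs s))
      (Suc (1 + (Suc 1 + (Suc (Suc (1 + Suc (Suc 1 + 1)) + k) + 0)) + t))" .
  have v: "evaluates ?p ?\<rho> (Var 1) (Branch (code a) (code zs)) 1"
    using evaluates_Var1 by simp
  have "evaluates ?p ?\<rho> (fold_body e) (code (fold (g x) xs s))
      (Suc (1 + Suc (1 + (Suc 1 + (Suc (Suc (1 + Suc (Suc 1 + 1)) + k) + 0)) + t)))"
    by (subst (2) fold_body_def) (rule evaluates_evaluates_list.IfLeaf_Branch[OF v c])
  with t(1) k(1) show ?case by (intro exI conjI) auto
qed

lemma poly_time_fold:
  fixes g :: "'x::coded \<Rightarrow> 'a::coded \<Rightarrow> 's::coded \<Rightarrow> 's"
  assumes "poly_time xs" "poly_time s"
    and "poly_time (\<lambda>p. g (fst p) (fst (snd p)) (snd (snd p)))"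
    and bound: "\<And>x ys zs. xs x = ys @ zs \<Longrightarrow>
      size (code (fold (g x) ys (s x))) \<le> poly b (size (code x))"
  shows "poly_time (\<lambda>x. fold (g x) (xs x) (s x))"
proof -
  let ?G = "\<lambda>p. g (fst p) (fst (snd p)) (snd (snd p))"
  obtain p e1 q1 e2 q2 e3 q3 where c: "computes p e1 q1 xs" "computes p e2 q2 s"
    "computes p e3 q3 ?G"
    by (rule poly_time_common_program3[OF assms(1-3)])
  \<comment> \<open>\<open>fold_body\<close> calls itself as function 0, so it takes the first place
    and everything else moves by one.\<close>
  define e where "e = shift_calls 1 e3"
  define P where "P = fold_body e # map (shift_calls 1) p"
  have C: "computes P (shift_calls 1 e1) q1 xs" "computes P (shift_calls 1 e2) q2 s"
    "computes P e q3 ?G"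
    using c[THEN computes_shift_calls, of "[fold_body e]"] by (simp_all add: P_def e_def)
  \<comment> \<open>Time of one step: the triple of input, element and accumulator is bounded by the
    input size plus 2 and the bounds on list and accumulator; the 2 counts the two pairing
    nodes.\<close>
  define Q where "Q = q3 \<circ>\<^sub>p ([:2, 1:] + q1 + b)"
  show ?thesis
  proof (rule poly_timeI)
    fix x :: 'x
    let ?n = "size (code x)"
    obtain t1 where t1: "evaluates P [code x] (shift_calls 1 e1) (code (xs x)) t1"
      "t1 + size (code (xs x)) \<le> poly q1 ?n"
      using C(1) by (rule computesE)
    obtain t2 where t2: "evaluates P [code x] (shift_calls 1 e2) (code (s x)) t2"
      "t2 + size (code (s x)) \<le> poly q2 ?n"
      using C(2) by (rule computesE)
    have step: "\<exists>t\<le>poly Q ?n. evaluates (fold_body e # map (shift_calls 1) p)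
        [code (x, a, fold (g x) ys (s x))] e (code (fold (g x) (ys @ [a]) (s x))) t"
      if "xs x = ys @ a # zs" for a ys zs
    proof -
      let ?y = "(x, a, fold (g x) ys (s x))"
      obtain t where t: "evaluates P [code ?y] e (code (?G ?y)) t"
        "t + size (code (?G ?y)) \<le> poly q3 (size (code ?y))"
        using C(3) by (rule computesE)
      have "size (code a) \<le> size (code (xs x))"
        using that by simp
      then have "size (code ?y) \<le> ?n + 2 + poly q1 ?n + poly b ?n"
        using bound[OF that] t1(2) by simp
      from poly_nat_mono[OF this, of q3] have "t \<le> poly Q ?n"
        using t(2) by (simp add: Q_def poly_pcompose add_ac)
      with t(1) show ?thesis by (auto simp: P_def)
    qed
    have "\<exists>t\<le>length (xs x) * (poly Q ?n + 20) + 5.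
        evaluates P [code x, code (xs x), code (fold (g x) [] (s x))] (fold_body e)
          (code (fold (g x) (xs x) (s x))) t"
      unfolding P_def by (rule evaluates_fold_body) (use step in auto)
    then obtain t where t: "t \<le> length (xs x) * (poly Q ?n + 20) + 5"
      "evaluates P [code x, code (xs x), code (s x)] (fold_body e)
        (code (fold (g x) (xs x) (s x))) t"
      by auto
    have "evaluates_list P [code x] [Var 0, shift_calls 1 e1, shift_calls 1 e2]
      [code x, code (xs x), code (s x)] (1 + (t1 + (t2 + 0)))"
      by (intro evaluates_evaluates_list.Cons evaluates_evaluates_list.Nil evaluates_Vars
          t1(1) t2(1))
    from evaluates_Call_0[OF this[unfolded P_def] t(2)[unfolded P_def]]
    have "evaluates P [code x] (Call 0 [Var 0, shift_calls 1 e1, shift_calls 1 e2])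
      (code (fold (g x) (xs x) (s x))) (Suc (1 + (t1 + (t2 + 0)) + t))"
      by (simp add: P_def)
    moreover have "t \<le> poly (q1 * (Q + 20) + 5) ?n"
      using t(1) t1(2) length_le_size_code[of "xs x"]
      by (auto intro!: order.trans[OF t(1)] mult_right_mono)
    then have "Suc (1 + (t1 + (t2 + 0)) + t) + size (code (fold (g x) (xs x) (s x))) \<le>
        poly (b + q1 + q2 + 2 + (q1 * (Q + 20) + 5)) ?n"
      using t1(2) t2(2) bound[of x "xs x" "[]"] by simp
    ultimately show "\<exists>t. evaluates P [code x] (Call 0 [Var 0, shift_calls 1 e1, shift_calls 1 e2])
          (code (fold (g x) (xs x) (s x))) t \<and>
        t + size (code (fold (g x) (xs x) (s x))) \<le>
        poly (b + q1 + q2 + 2 + (q1 * (Q + 20) + 5)) ?n"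
      by blast
  qed
qed

text \<open>A step that enlarges the accumulator by an additive polynomial amount may be iterated;
  a step that doubles it may not.\<close>

lemma poly_time_fold_additive:
  fixes g :: "'x::coded \<Rightarrow> 'a::coded \<Rightarrow> 's::coded \<Rightarrow> 's"
  assumes "poly_time xs" "poly_time s"
    and "poly_time (\<lambda>p. g (fst p) (fst (snd p)) (snd (snd p)))"
    and incr: "\<And>x a r. size (code (g x a r)) \<le>
      size (code r) + poly b (size (code x) + size (code a))"
  shows "poly_time (\<lambda>x. fold (g x) (xs x) (s x))"
proof -
  obtain q1 where q1: "\<And>x. size (code (xs x)) \<le> poly q1 (size (code x))"
    using poly_time_size[OF assms(1)] by metis
  obtain q2 where q2: "\<And>x. size (code (s x)) \<le> poly q2 (size (code x))"
    using poly_time_size[OF assms(2)] by metis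
  let ?b = "b \<circ>\<^sub>p ([:0, 1:] + q1)"
  show ?thesis
  proof (rule poly_time_fold[OF assms(1-3)])
    fix x :: 'x and ys zs
    assume xs: "xs x = ys @ zs"
    let ?n = "size (code x)"
    have "size (code (fold (g x) ys r)) \<le> size (code r) + length ys * poly ?b ?n"
      if "set ys \<subseteq> set (xs x)" for ys r
      using that
    proof (induction ys arbitrary: r)
      case (Cons a ys)
      have "size (code a) \<le> poly q1 ?n"
        using Cons.prems size_code_member[of a "xs x"] q1[of x] by simp
      then have "poly b (?n + size (code a)) \<le> poly ?b ?n"
        using poly_nat_mono[of "?n + size (code a)" "?n + poly q1 ?n" b]
        by (simp add: poly_pcompose)
      with incr[of x a r] have "size (code (g x a r)) \<le> size (code r) + poly ?b ?n" by simp
      with Cons.IH[of "g x a r"] Cons.prems show ?case by simp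
    qed simp
    from this[of ys "s x"] xs
    have "size (code (fold (g x) ys (s x))) \<le> size (code (s x)) + length ys * poly ?b ?n"
      by simp
    also have "\<dots> \<le> poly q2 ?n + poly q1 ?n * poly ?b ?n"
      using q1[of x] q2[of x] length_le_size_code[of ys] xs
      by (intro add_mono mult_right_mono) auto
    finally show "size (code (fold (g x) ys (s x))) \<le> poly (q2 + q1 * ?b) ?n"
      by simp
  qed
qed

section \<open>Closure under connectives and list operations\<close>

named_theorems poly_time_intros

lemmas [poly_time_intros] = poly_time_const poly_time_id poly_time_Pair poly_time_fst
  poly_time_snd poly_time_Cons poly_time_tl poly_time_If poly_time_eq poly_time_Suc

text \<open>A function of several arguments is measured as a function of their tuple. In the list
  operations below, the function applied to the elements receives the outer input as the first
  component of a pair, which replaces a closure.\<close>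

lemma poly_time_uncurry:
  assumes "poly_time (\<lambda>p. h (fst p) (snd p))" "poly_time f" "poly_time g"
  shows "poly_time (\<lambda>x. h (f x) (g x))"
  using poly_time_comp[OF poly_time_Pair[OF assms(2,3)] assms(1)] by simp

lemma poly_time_conj [poly_time_intros]:
  assumes "poly_time f" "poly_time g"
  shows "poly_time (\<lambda>x. f x \<and> g x)"
  by (rule back_subst[of poly_time, OF poly_time_If[OF assms poly_time_const[of False]]]) auto

lemma poly_time_disj [poly_time_intros]:
  assumes "poly_time f" "poly_time g"
  shows "poly_time (\<lambda>x. f x \<or> g x)"
  by (rule back_subst[of poly_time, OF poly_time_If[OF assms(1) poly_time_const[of True] assms(2)]])
    auto

lemma poly_time_Not [poly_time_intros]:
  assumes "poly_time f"
  shows "poly_time (\<lambda>x. \<not> f x)"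
  by (rule back_subst[of poly_time,
        OF poly_time_If[OF assms poly_time_const[of False] poly_time_const[of True]]]) auto

lemma poly_time_rev [poly_time_intros]:
  assumes "poly_time xs"
  shows "poly_time (\<lambda>x. rev (xs x))"
proof -
  have "poly_time (\<lambda>x. fold (\<lambda>a r. a # r) (xs x) [])"
    by (rule poly_time_fold_additive[where b = "[:1, 1:]"])
      (intro poly_time_intros assms | simp)+
  then show ?thesis by (simp add: fold_Cons_rev)
qed

lemma poly_time_append [poly_time_intros]:
  assumes "poly_time xs" "poly_time ys"
  shows "poly_time (\<lambda>x. xs x @ ys x)"
proof -
  have "poly_time (\<lambda>x. fold (\<lambda>a r. a # r) (rev (xs x)) (ys x))"
    by (rule poly_time_fold_additive[where b = "[:1, 1:]"])
      (intro poly_time_intros assms | simp)+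
  then show ?thesis by (simp add: fold_Cons_rev)
qed

lemma fold_append_concat: "fold (\<lambda>a r. r @ f a) xs ys = ys @ concat (map f xs)"
  by (induction xs arbitrary: ys) auto

lemma poly_time_concat_map [poly_time_intros]:
  assumes "poly_time xs" and f: "poly_time (\<lambda>p. f (fst p) (snd p))"
  shows "poly_time (\<lambda>x. concat (map (f x) (xs x)))"
proof -
  obtain q where q: "\<And>p. size (code (f (fst p) (snd p))) \<le> poly q (size (code p))"
    using poly_time_size[OF f] by metis
  have "poly_time (\<lambda>x. fold (\<lambda>a r. r @ f x a) (xs x) [])"
  proof (rule poly_time_fold_additive[where b = "q \<circ>\<^sub>p [:1, 1:]"])
    show "poly_time (\<lambda>p. snd (snd p) @ f (fst p) (fst (snd p)))"
      by (intro poly_time_uncurry[OF f] poly_time_intros)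
    show "size (code (r @ f x a)) \<le>
        size (code r) + poly (q \<circ>\<^sub>p [:1, 1:]) (size (code x) + size (code a))" for x a r
      using q[of "(x, a)"] by (simp add: poly_pcompose)
  qed (intro poly_time_intros assms)+
  then show ?thesis by (simp add: fold_append_concat)
qed

lemma poly_time_map [poly_time_intros]:
  assumes "poly_time xs" "poly_time (\<lambda>p. f (fst p) (snd p))"
  shows "poly_time (\<lambda>x. map (f x) (xs x))"
proof -
  have "poly_time (\<lambda>x. concat (map (\<lambda>a. [f x a]) (xs x)))"
    by (intro poly_time_intros assms)
  then show ?thesis by (simp add: concat_map_singleton)
qed

lemma poly_time_filter [poly_time_intros]:
  assumes "poly_time xs" "poly_time (\<lambda>p. P (fst p) (snd p))"
  shows "poly_time (\<lambda>x. filter (P x) (xs x))"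
proof -
  have "poly_time (\<lambda>x. concat (map (\<lambda>a. if P x a then [a] else []) (xs x)))"
    by (intro poly_time_intros assms)
  moreover have "concat (map (\<lambda>a. if P x a then [a] else []) ys) = filter (P x) ys" for x ys
    by (induction ys) auto
  ultimately show ?thesis by simp
qed

lemma poly_time_Bex [poly_time_intros]:
  assumes "poly_time xs" "poly_time (\<lambda>p. P (fst p) (snd p))"
  shows "poly_time (\<lambda>x. \<exists>a\<in>set (xs x). P x a)"
proof -
  have "poly_time (\<lambda>x. filter (P x) (xs x) \<noteq> [])"
    by (intro poly_time_intros assms)
  then show ?thesis by (simp add: filter_empty_conv)
qed

lemma poly_time_Ball [poly_time_intros]:
  assumes "poly_time xs" "poly_time (\<lambda>p. P (fst p) (snd p))"
  shows "poly_time (\<lambda>x. \<forall>a\<in>set (xs x). P x a)"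
proof -
  have "poly_time (\<lambda>x. \<not> (\<exists>a\<in>set (xs x). \<not> P x a))"
    by (intro poly_time_intros assms)
  then show ?thesis by simp
qed

lemma poly_time_member [poly_time_intros]:
  assumes "poly_time f" "poly_time xs"
  shows "poly_time (\<lambda>x. f x \<in> set (xs x))"
proof -
  have "poly_time (\<lambda>x. \<exists>a\<in>set (xs x). f x = a)"
    by (intro poly_time_intros assms poly_time_comp[OF _ assms(1)])
  then show ?thesis by simp
qed

lemma poly_time_product [poly_time_intros]:
  assumes "poly_time xs" "poly_time ys"
  shows "poly_time (\<lambda>x. List.product (xs x) (ys x))"
proof -
  have "poly_time (\<lambda>x. concat (map (\<lambda>a. map (Pair a) (ys x)) (xs x)))"
    by (intro poly_time_intros assms poly_time_comp[OF _ assms(2)])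
  then show ?thesis by (simp add: product_concat_map)
qed

lemma poly_time_distinct [poly_time_intros]:
  fixes xs :: "'a::coded \<Rightarrow> 'b::coded list"
  assumes "poly_time xs"
  shows "poly_time (\<lambda>x. distinct (xs x))"
proof -
  let ?f = "\<lambda>a r. (a # fst r, snd r \<and> a \<notin> set (fst r))"
  have "poly_time (\<lambda>x. fold ?f (xs x) ([], True))"
  proof (rule poly_time_fold_additive[where b = "[:4, 1:]"])
    show "size (code (?f a r)) \<le> size (code r) + poly [:4, 1:] (size (code x) + size (code a))"
      for x :: 'a and a :: 'b and r
      by (cases r) (auto simp: code_bool_def)
  qed (intro poly_time_intros assms)+
  then have "poly_time (\<lambda>x. snd (fold ?f (xs x) ([], True)))"
    by (rule poly_time_snd)
  moreover have "snd (fold ?f ys (zs, b)) \<longleftrightarrow> b \<and> distinct ys \<and> set ys \<inter> set zs = {}"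
    for ys zs :: "'b list" and b
    by (induction ys arbitrary: zs b) auto
  then have "(\<lambda>x. snd (fold ?f (xs x) ([], True))) = (\<lambda>x. distinct (xs x))"
    by (intro ext) simp
  ultimately show ?thesis by metis
qed

lemma size_code_tl: "size (code (tl xs)) \<le> size (code xs)"
  by (cases xs) auto

definition longer :: "'a list \<Rightarrow> 'b list \<Rightarrow> bool" where
  "longer xs ys \<longleftrightarrow> length ys < length xs"

text \<open>Lengths are compared by dropping entries of one list along the other, which is a fold,
  instead of by arithmetic on binary numbers.\<close>

lemma poly_time_longer [poly_time_intros]:
  fixes xs :: "'a::coded \<Rightarrow> 'b::coded list" and ys :: "'a::coded \<Rightarrow> 'c::coded list"
  assumes "poly_time xs" "poly_time ys"
  shows "poly_time (\<lambda>x. longer (xs x) (ys x))"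
proof -
  have "poly_time (\<lambda>x. fold (\<lambda>a. tl) (ys x) (xs x) \<noteq> [])"
    by (intro poly_time_Not poly_time_eq poly_time_fold_additive[where b = 0]
        poly_time_intros assms) (auto intro: size_code_tl)
  moreover have "fold (\<lambda>a. tl) vs us = drop (length vs) us" for us :: "'b list" and vs :: "'c list"
    by (induction vs arbitrary: us) (auto simp: drop_Suc)
  ultimately show ?thesis by (simp add: longer_def not_le)
qed

text \<open>The parameter is binary, so counting down from it could take exponentially many steps.
  The loop runs along the list instead, counts upwards and records whether the count has ever met
  \<open>k x\<close>; the initial flag accounts for the count 0.\<close>

lemma poly_time_le_length [poly_time_intros]:
  fixes xs :: "'a::coded \<Rightarrow> 'b::coded list"
  assumes "poly_time k" "poly_time xs"
  shows "poly_time (\<lambda>x. k x \<le> length (xs x))"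
proof -
  let ?f = "\<lambda>x a r. (Suc (fst r), snd r \<or> Suc (fst r) = k x)"
  have "poly_time (\<lambda>x. fold (?f x) (xs x) (0, k x = 0))"
  proof (rule poly_time_fold_additive[where b = "[:5:]"])
    show "size (code (?f x a r)) \<le> size (code r) + poly [:5:] (size (code x) + size (code a))"
      for x and a :: 'b and r
      using size_code_Suc[of "fst r"] by (cases r) (auto simp: code_bool_def)
  qed (intro poly_time_intros assms poly_time_comp[OF _ assms(1)])+
  then have "poly_time (\<lambda>x. snd (fold (?f x) (xs x) (0, k x = 0)))"
    by (rule poly_time_snd)
  moreover have "snd (fold (?f x) ys (m, b)) \<longleftrightarrow> b \<or> (m < k x \<and> k x \<le> m + length ys)"
    for x b m and ys :: "'b list"
    by (induction ys arbitrary: m b) auto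
  then have "(\<lambda>x. snd (fold (?f x) (xs x) (0, k x = 0))) = (\<lambda>x. k x \<le> length (xs x))"
    by (intro ext) auto
  ultimately show ?thesis by metis
qed

definition pick :: "('a \<Rightarrow> bool) \<Rightarrow> 'a list \<Rightarrow> 'a \<Rightarrow> 'a" where
  "pick P xs d = fold (\<lambda>x r. if P x then x else r) xs d"

lemma pick_cases: "(pick P xs d \<in> set xs \<and> P (pick P xs d)) \<or>
    (pick P xs d = d \<and> (\<forall>x\<in>set xs. \<not> P x))"
  unfolding pick_def by (induction xs arbitrary: d) (auto, metis+)

lemma poly_time_pick [poly_time_intros]:
  assumes "poly_time (\<lambda>p. P (fst p) (snd p))" "poly_time xs" "poly_time d"
  shows "poly_time (\<lambda>x. pick (P x) (xs x) (d x))"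
  unfolding pick_def
  by (rule poly_time_fold_additive[where b = "[:0, 1:]"])
    (intro poly_time_intros assms poly_time_uncurry[OF assms(1)] | simp)+


section \<open>Iterated improvement\<close>

text \<open>As long as the state moves, \<open>\<Phi>\<close> grows by at least one per step, so
  after \<open>n\<close> steps the state is fixed or \<open>\<Phi>\<close> has reached
  \<open>n\<close>. The entries of \<open>ts\<close> are ignored; it is a counter that turns a loop
  with a stopping condition into a fold.\<close>

lemma fold_fixpoint:
  fixes \<Phi> :: "'s \<Rightarrow> nat"
  assumes "I s" and step: "\<And>s. I s \<Longrightarrow> I (f s) \<and> (f s = s \<or> \<Phi> s < \<Phi> (f s))"
    and bound: "\<And>s. I s \<Longrightarrow> \<Phi> s < length ts"
  defines "r \<equiv> fold (\<lambda>_. f) ts s"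
  shows "I r" "f r = r"
proof -
  have r: "r = (f ^^ length ts) s"
    unfolding r_def by (induction ts arbitrary: s) (auto simp: funpow_swap1)
  have I: "I ((f ^^ n) s)" for n
    using assms(1) step by (induction n) auto
  have "f ((f ^^ n) s) = (f ^^ n) s \<or> n \<le> \<Phi> ((f ^^ n) s)" for n
  proof (induction n)
    case (Suc n)
    then show ?case
      using step[OF I[of n]] step[OF I[of "Suc n"]] by fastforce
  qed simp
  from this[of "length ts"] show "f r = r" "I r"
    using bound[OF I] I unfolding r by (auto simp: not_le[symmetric])
qed


section \<open>Locally optimal packings\<close>

definition adj :: "('a \<times> 'a) list \<Rightarrow> 'a \<Rightarrow> 'a \<Rightarrow> bool" where
  "adj es u v \<longleftrightarrow> (u, v) \<in> set es \<or> (v, u) \<in> set es"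

lemma adj_commute: "adj es u v \<longleftrightarrow> adj es v u"
  by (auto simp: adj_def)

definition path_list :: "'a \<times> 'a \<times> 'a \<Rightarrow> 'a list" where
  "path_list p = [fst p, fst (snd p), snd (snd p)]"

lemma path_list_triple [simp]: "path_list (u, v, w) = [u, v, w]"
  by (simp add: path_list_def)

definition covered :: "('a \<times> 'a \<times> 'a) list \<Rightarrow> 'a list" where
  "covered P = concat (map path_list P)"

lemma covered_simps [simp]:
  "covered [] = []" "covered (p # P) = path_list p @ covered P"
  "covered (P @ Q) = covered P @ covered Q"
  by (simp_all add: covered_def)

lemma length_covered: "length (covered P) = 3 * length P"
  by (induction P) (simp_all add: path_list_def)

lemma path_list_subset_covered: "p \<in> set P \<Longrightarrow> set (path_list p) \<subseteq> set (covered P)"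
  by (auto simp: covered_def)

lemma covered_remove:
  assumes "distinct (covered P)" "L \<in> set P"
  shows "distinct (covered (filter (\<lambda>p. p \<noteq> L) P))"
    and "set (covered (filter (\<lambda>p. p \<noteq> L) P)) = set (covered P) - set (path_list L)"
    and "Suc (length (filter (\<lambda>p. p \<noteq> L) P)) = length P"
proof -
  obtain xs ys where P: "P = xs @ L # ys"
    using assms(2) by (meson split_list)
  \<comment> \<open>A second copy of \<open>L\<close> would repeat the vertex \<open>fst L\<close>
    in \<open>covered P\<close>.\<close>
  have "fst L \<in> set (path_list L)" by (simp add: path_list_def)
  then have "L \<notin> set xs" "L \<notin> set ys"
    using assms(1) path_list_subset_covered[of L xs] path_list_subset_covered[of L ys]
    unfolding P by auto
  then have "filter (\<lambda>p. p \<noteq> L) xs = xs" "filter (\<lambda>p. p \<noteq> L) ys = ys"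
    by (auto simp: filter_id_conv)
  then have "filter (\<lambda>p. p \<noteq> L) P = xs @ ys"
    unfolding P by simp
  then show "distinct (covered (filter (\<lambda>p. p \<noteq> L) P))"
    and "set (covered (filter (\<lambda>p. p \<noteq> L) P)) = set (covered P) - set (path_list L)"
    and "Suc (length (filter (\<lambda>p. p \<noteq> L) P)) = length P"
    using assms(1) unfolding P by auto
qed

definition path_in :: "('a \<times> 'a) list \<Rightarrow> 'a \<times> 'a \<times> 'a \<Rightarrow> bool" where
  "path_in es p \<longleftrightarrow> distinct (path_list p) \<and>
     adj es (fst p) (fst (snd p)) \<and> adj es (fst (snd p)) (snd (snd p))"

definition packing_in :: "('a \<times> 'a) list \<Rightarrow> ('a \<times> 'a \<times> 'a) list \<Rightarrow> bool" where
  "packing_in es P \<longleftrightarrow> distinct (covered P) \<and> (\<forall>p\<in>set P. path_in es p)"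

definition free_edges :: "('a \<times> 'a) list \<Rightarrow> ('a \<times> 'a \<times> 'a) list \<Rightarrow> ('a \<times> 'a) list" where
  "free_edges es P =
     filter (\<lambda>e. fst e \<notin> set (covered P) \<and> snd e \<notin> set (covered P)) es"

text \<open>Candidates come from arbitrary triples of vertices, so the comparison itself has to
  reject those that are no packings.\<close>

definition better ::
    "('a \<times> 'a) list \<Rightarrow> ('a \<times> 'a \<times> 'a) list \<Rightarrow> ('a \<times> 'a \<times> 'a) list \<Rightarrow> bool" where
  "better es Q P \<longleftrightarrow> packing_in es Q \<and>
     (longer Q P \<or> (\<not> longer P Q \<and> longer (free_edges es Q) (free_edges es P)))"

definition triples :: "'a list \<Rightarrow> ('a \<times> 'a \<times> 'a) list" where
  "triples vs = List.product vs (List.product vs vs)"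

lemma triples_iff: "p \<in> set (triples vs) \<longleftrightarrow> set (path_list p) \<subseteq> set vs"
  by (cases p) (auto simp: triples_def)

text \<open>The removed triple ranges over all triples. If it is no path of \<open>P\<close>,
  nothing is removed and the exchange is a pure extension. At most nine vertices are chosen, so the
  number of candidates is polynomial.\<close>

definition exchanges ::
    "'a list \<Rightarrow> ('a \<times> 'a \<times> 'a) list \<Rightarrow> ('a \<times> 'a \<times> 'a) list list" where
  "exchanges vs P = concat (map
     (\<lambda>r. [fst r # filter (\<lambda>p. p \<noteq> snd (snd r)) P,
           fst r # fst (snd r) # filter (\<lambda>p. p \<noteq> snd (snd r)) P])
     (List.product (triples vs) (List.product (triples vs) (triples vs))))"

lemma exchanges_iff: "Q \<in> set (exchanges vs P) \<longleftrightarrow>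
    (\<exists>A\<in>set (triples vs). \<exists>B\<in>set (triples vs). \<exists>L\<in>set (triples vs).
      Q = A # filter (\<lambda>p. p \<noteq> L) P \<or> Q = A # B # filter (\<lambda>p. p \<noteq> L) P)"
  unfolding exchanges_def by auto

lemma exchanges_one:
  assumes "A \<in> set (triples vs)" "L \<in> set (triples vs)"
  shows "A # filter (\<lambda>p. p \<noteq> L) P \<in> set (exchanges vs P)"
proof -
  have *: "(A, A, L) \<in> set (List.product (triples vs) (List.product (triples vs) (triples vs)))"
    using assms by simp
  show ?thesis
    unfolding exchanges_def set_concat set_map by (rule UnionI[OF imageI[OF imageI[OF *]]]) simp
qed

lemma exchanges_two:
  assumes "A \<in> set (triples vs)" "B \<in> set (triples vs)" "L \<in> set (triples vs)"
  shows "A # B # filter (\<lambda>p. p \<noteq> L) P \<in> set (exchanges vs P)"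
proof -
  have *: "(A, B, L) \<in> set (List.product (triples vs) (List.product (triples vs) (triples vs)))"
    using assms by simp
  show ?thesis
    unfolding exchanges_def set_concat set_map by (rule UnionI[OF imageI[OF imageI[OF *]]]) simp
qed
definition improve ::
    "'a list \<Rightarrow> ('a \<times> 'a) list \<Rightarrow> ('a \<times> 'a \<times> 'a) list \<Rightarrow> ('a \<times> 'a \<times> 'a) list" where
  "improve vs es P = pick (\<lambda>Q. better es Q P) (exchanges vs P) P"

text \<open>The product list is only a counter; it is longer than any sequence of improvements.\<close>

definition local_packing :: "nat list \<Rightarrow> (nat \<times> nat) list \<Rightarrow> (nat \<times> nat \<times> nat) list" where
  "local_packing vs es =
     fold (\<lambda>_. improve vs es) (List.product (0 # vs) ((0, 0) # es)) []"

definition locally_optimal :: "'a list \<Rightarrow> ('a \<times> 'a) list \<Rightarrow> ('a \<times> 'a \<times> 'a) list \<Rightarrow> bool" where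
  "locally_optimal vs es P \<longleftrightarrow> packing_in es P \<and> set (covered P) \<subseteq> set vs \<and>
     (\<forall>Q\<in>set (exchanges vs P). \<not> better es Q P)"

lemma locally_optimal_local_packing: "locally_optimal vs es (local_packing vs es)"
proof -
  let ?I = "\<lambda>P. packing_in es P \<and> set (covered P) \<subseteq> set vs"
  \<comment> \<open>The factor \<open>Suc (length es)\<close> exceeds any number of free edges and
    turns the lexicographic order into a single number. Three times the number of paths is at most
    \<open>length vs\<close>, so the potential stays below the length of the counter list, whose
    extra entries \<open>0\<close> and \<open>(0, 0)\<close> make the inequality strict.\<close>
  let ?\<Phi> = "\<lambda>P. length P * Suc (length es) + length (free_edges es P)"
  let ?ts = "List.product (0 # vs) ((0, 0) # es)"
  have free: "length (free_edges es P) \<le> length es" for P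
    by (simp add: free_edges_def)
  have \<Phi>: "?\<Phi> P < ?\<Phi> Q" if "better es Q P" for P Q
  proof (cases "longer Q P")
    case True
    then have "Suc (length P) * Suc (length es) \<le> length Q * Suc (length es)"
      by (intro mult_right_mono) (auto simp: longer_def)
    with free[of P] show ?thesis by simp
  next
    case False
    with that have "length Q = length P" "length (free_edges es P) < length (free_edges es Q)"
      by (auto simp: better_def longer_def)
    then show ?thesis by simp
  qed
  have step: "?I (improve vs es P) \<and> (improve vs es P = P \<or> ?\<Phi> P < ?\<Phi> (improve vs es P))"
    if I: "?I P" for P
    using pick_cases[of "\<lambda>Q. better es Q P" "exchanges vs P" P]
  proof
    assume *: "pick (\<lambda>Q. better es Q P) (exchanges vs P) P \<in> set (exchanges vs P) \<and>
      better es (pick (\<lambda>Q. better es Q P) (exchanges vs P) P) P"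
    then obtain A B L where AB: "set (path_list A) \<subseteq> set vs" "set (path_list B) \<subseteq> set vs"
      and "improve vs es P = A # filter (\<lambda>p. p \<noteq> L) P \<or>
       improve vs es P = A # B # filter (\<lambda>p. p \<noteq> L) P"
      unfolding exchanges_iff Bex_def triples_iff improve_def[symmetric] by blast
    moreover have "set (covered (filter (\<lambda>p. p \<noteq> L) P)) \<subseteq> set (covered P)"
      by (auto simp: covered_def)
    ultimately have "set (covered (improve vs es P)) \<subseteq>
        set (path_list A) \<union> set (path_list B) \<union> set (covered P)"
      by (elim disjE) auto
    then have "set (covered (improve vs es P)) \<subseteq> set vs"
      using I AB by blast
    moreover have b: "better es (improve vs es P) P"
      using * by (simp add: improve_def)
    moreover have "packing_in es (improve vs es P)"
      using b by (simp add: better_def)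
    ultimately show ?thesis
      using \<Phi>[OF b] by simp
  qed (use I in \<open>auto simp: improve_def\<close>)
  have bound: "?\<Phi> P < length ?ts" if "?I P" for P
  proof -
    have "3 * length P = card (set (covered P))"
      using that by (simp add: packing_in_def distinct_card length_covered)
    also have "\<dots> \<le> card (set vs)"
      using that by (intro card_mono) auto
    also have "\<dots> \<le> length vs"
      by (rule card_length)
    finally have "length P * Suc (length es) \<le> length vs * Suc (length es)"
      by (intro mult_right_mono) auto
    with free[of P] show ?thesis by (simp add: length_product)
  qed
  have start: "?I []"
    by (simp add: packing_in_def)
  note fixpoint = fold_fixpoint[where I = ?I and \<Phi> = ?\<Phi> and ts = ?ts, OF start step bound,
      folded local_packing_def]
  \<comment> \<open>If some candidate were better, \<open>pick\<close> would return a better one; at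
    the fixed point that is the packing itself, which cannot exceed its own potential.\<close>
  have "\<not> better es Q (local_packing vs es)" if "Q \<in> set (exchanges vs (local_packing vs es))" for Q
    using pick_cases[of "\<lambda>Q. better es Q (local_packing vs es)"
        "exchanges vs (local_packing vs es)" "local_packing vs es"] that
      fixpoint(2) \<Phi>[of "local_packing vs es" "local_packing vs es"]
    unfolding improve_def by auto
  then show ?thesis
    unfolding locally_optimal_def using fixpoint(1) by blast
qed

section \<open>What local optimality excludes\<close>

locale optimal_packing =
  fixes vs :: "'a list" and es :: "('a \<times> 'a) list" and P :: "('a \<times> 'a \<times> 'a) list"
  assumes edge_in: "(u, v) \<in> set es \<Longrightarrow> u \<noteq> v \<and> u \<in> set vs \<and> v \<in> set vs"
    and edge_once: "(u, v) \<in> set es \<Longrightarrow> (v, u) \<notin> set es"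
    and optimal: "locally_optimal vs es P"
begin

lemma adj_in: "adj es u v \<Longrightarrow> u \<noteq> v \<and> u \<in> set vs \<and> v \<in> set vs"
  by (auto simp: adj_def dest: edge_in)

lemma path_in_verts: "path_in es p \<Longrightarrow> set (path_list p) \<subseteq> set vs"
  by (auto simp: path_in_def path_list_def dest: adj_in)

definition free :: "'a set" where
  "free = set vs - set (covered P)"

lemma distinct_covered: "distinct (covered P)"
  and path_in_P: "p \<in> set P \<Longrightarrow> path_in es p"
  using optimal by (auto simp: locally_optimal_def packing_in_def)

lemma packing_in_remove: "packing_in es (filter (\<lambda>p. p \<noteq> L) P)"
proof (cases "L \<in> set P")
  case True
  then show ?thesis
    using covered_remove(1)[OF distinct_covered] path_in_P by (auto simp: packing_in_def)
next
  case False
  then have "filter (\<lambda>p. p \<noteq> L) P = P" by (auto simp: filter_id_conv)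
  then show ?thesis using distinct_covered path_in_P by (auto simp: packing_in_def)
qed

lemma path_in_triples: "path_in es p \<Longrightarrow> p \<in> set (triples vs)"
  by (simp only: triples_iff path_in_verts)

lemma not_better_one:
  assumes "path_in es A" "path_in es L"
  shows "\<not> better es (A # filter (\<lambda>p. p \<noteq> L) P) P"
proof -
  have "A # filter (\<lambda>p. p \<noteq> L) P \<in> set (exchanges vs P)"
    by (intro exchanges_one path_in_triples assms)
  with optimal show ?thesis unfolding locally_optimal_def by (elim conjE bspec)
qed

lemma not_better_two:
  assumes "path_in es A" "path_in es B" "path_in es L"
  shows "\<not> better es (A # B # filter (\<lambda>p. p \<noteq> L) P) P"
proof -
  have "A # B # filter (\<lambda>p. p \<noteq> L) P \<in> set (exchanges vs P)"
    by (intro exchanges_two path_in_triples assms)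
  with optimal show ?thesis unfolding locally_optimal_def by (elim conjE bspec)
qed

text \<open>Such an \<open>A\<close> is not in \<open>P\<close>, so taking \<open>A\<close> also as
  the removed path removes nothing, and the exchange adds a path.\<close>

lemma no_free_path:
  assumes "path_in es A" "set (path_list A) \<subseteq> free"
  shows False
proof -
  have "fst A \<in> set (path_list A)" by (simp add: path_list_def)
  then have "A \<notin> set P"
    using assms(2) path_list_subset_covered[of A P] by (auto simp: free_def)
  then have "filter (\<lambda>p. p \<noteq> A) P = P" by (auto simp: filter_id_conv)
  moreover have "set (path_list A) \<inter> set (covered P) = {}"
    using assms(2) by (auto simp: free_def)
  ultimately have "better es (A # filter (\<lambda>p. p \<noteq> A) P) P"
    using assms(1) packing_in_remove[of A]
    by (auto simp: better_def longer_def packing_in_def path_in_def)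
  with not_better_one[OF assms(1,1)] show False ..
qed

text \<open>Replacing \<open>L\<close> by two disjoint paths would raise the number of paths. This
  later limits each path of \<open>P\<close> to one matched edge.\<close>

lemma no_augmentation:
  assumes "L \<in> set P" "path_in es A" "path_in es B"
    and "set (path_list A) \<subseteq> set (path_list L) \<union> free"
    and "set (path_list B) \<subseteq> set (path_list L) \<union> free"
    and "set (path_list A) \<inter> set (path_list B) = {}"
  shows False
proof -
  let ?R = "filter (\<lambda>p. p \<noteq> L) P"
  note R = covered_remove[OF distinct_covered assms(1)]
  have "set (path_list A) \<inter> set (covered ?R) = {}" "set (path_list B) \<inter> set (covered ?R) = {}"
    using assms(4,5) unfolding R(2) free_def by blast+
  then have "packing_in es (A # B # ?R)"
    using assms(2,3,6) packing_in_remove[of L] by (auto simp: packing_in_def path_in_def)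
  with R(3) have "better es (A # B # ?R) P"
    by (simp add: better_def longer_def)
  with not_better_two[OF assms(2,3) path_in_P[OF assms(1)]] show False ..
qed

definition isolated :: "'a set" where
  "isolated = {x \<in> free. \<forall>y. adj es x y \<longrightarrow> y \<in> set (covered P)}"

text \<open>The number of paths stays the same. From outside, \<open>A\<close> takes only isolated
  vertices, so no free edge is lost, while \<open>y\<close> leaves the packing and the edge
  \<open>yz\<close> becomes free.\<close>

lemma no_exchange:
  assumes "L \<in> set P" "path_in es A" "set (path_list A) \<subseteq> set (path_list L) \<union> isolated"
    and "adj es y z" "y \<in> set (path_list L)" "z \<in> isolated"
    and "y \<notin> set (path_list A)" "z \<notin> set (path_list A)"
  shows False
proof -
  let ?Q = "A # filter (\<lambda>p. p \<noteq> L) P"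
  have Q: "set (covered ?Q) = set (path_list A) \<union> (set (covered P) - set (path_list L))"
    using covered_remove(2)[OF distinct_covered assms(1)] by simp
  have y: "y \<in> set (covered P)"
    using assms(1,5) path_list_subset_covered by blast
  have z: "z \<notin> set (covered P)"
    using assms(6) by (auto simp: isolated_def free_def)
  obtain e where e: "e \<in> set es" "e = (y, z) \<or> e = (z, y)"
    using assms(4) by (auto simp: adj_def)
  have "fst d \<notin> set (path_list A) \<and> snd d \<notin> set (path_list A)"
    if d: "d \<in> set es" "fst d \<notin> set (covered P)" "snd d \<notin> set (covered P)" for d
  proof -
    have "adj es (fst d) (snd d)" "adj es (snd d) (fst d)"
      using d(1) by (auto simp: adj_def)
    then have "fst d \<notin> isolated" "snd d \<notin> isolated"
      using d by (auto simp: isolated_def)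
    with d(2,3) show ?thesis
      using assms(1,3) path_list_subset_covered by blast
  qed
  then have sub: "set (free_edges es P) \<subseteq> set (free_edges es ?Q)"
    unfolding free_edges_def Q by auto
  have "e \<in> set (free_edges es ?Q)" "e \<notin> set (free_edges es P)"
    using e assms(5,7,8) y z unfolding free_edges_def Q by auto
  \<comment> \<open>Both lists filter \<open>es\<close> in the same order, so the inclusion of sets
    makes one a filter of the other, and \<open>e\<close> makes it a proper one.\<close>
  moreover have "free_edges es P = filter (\<lambda>d. d \<in> set (free_edges es P)) (free_edges es ?Q)"
    using sub unfolding free_edges_def filter_filter by (intro filter_cong) auto
  ultimately have "length (free_edges es P) < length (free_edges es ?Q)"
    by (metis length_filter_less)
  moreover have "set (path_list A) \<inter> set (covered (filter (\<lambda>p. p \<noteq> L) P)) = {}"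
    using assms(3) unfolding covered_remove(2)[OF distinct_covered assms(1)] isolated_def free_def
    by blast
  then have "packing_in es ?Q"
    using assms(2) packing_in_remove[of L] by (auto simp: packing_in_def path_in_def)
  ultimately have "better es ?Q P"
    using covered_remove(3)[OF distinct_covered assms(1)] by (simp add: better_def longer_def)
  with not_better_one[OF assms(2) path_in_P[OF assms(1)]] show False ..
qed

end


section \<open>Matching by auction\<close>

text \<open>The state is a pair \<open>(M, H)\<close>: the current matching of items to slots, and the list of all
  bids so far. The price of a slot is the number of bids on it. An unmatched item bids on a
  cheapest slot that it is compatible with and displaces the owner, as long as the price is at
  most the number of slots.\<close>

definition may_bid :: "('i \<Rightarrow> 's \<Rightarrow> bool) \<Rightarrow> 's list \<Rightarrow> ('i \<times> 's) list \<times> 's list \<Rightarrow> 'i \<times> 's \<Rightarrow> bool"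
  where
  "may_bid E slots st b \<longleftrightarrow> E (fst b) (snd b) \<and> fst b \<notin> set (map fst (fst st)) \<and>
     \<not> longer (filter ((=) (snd b)) (snd st)) slots \<and>
     (\<forall>s\<in>set slots. E (fst b) s \<longrightarrow>
        \<not> longer (filter ((=) (snd b)) (snd st)) (filter ((=) s) (snd st)))"

definition place_bid :: "('i \<times> 's) list \<times> 's list \<Rightarrow> 'i \<times> 's \<Rightarrow> ('i \<times> 's) list \<times> 's list" where
  "place_bid st b = (b # filter (\<lambda>c. snd c \<noteq> snd b) (fst st), snd b # snd st)"

text \<open>Every admissible bid is placed on the old state \<open>st\<close> and the accumulator is
  dropped, so a single bid takes effect, the last one listed.\<close>

definition auction_step ::
    "('i \<Rightarrow> 's \<Rightarrow> bool) \<Rightarrow> 'i list \<Rightarrow> 's list \<Rightarrow> ('i \<times> 's) list \<times> 's list \<Rightarrow> ('i \<times> 's) list \<times> 's list"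
  where
  "auction_step E items slots st = fold (\<lambda>b r. place_bid st b)
     (filter (may_bid E slots st) (List.product items slots)) st"

lemma auction_step_cases:
  "(auction_step E items slots st = st \<and>
      (\<forall>i\<in>set items. \<forall>s\<in>set slots. \<not> may_bid E slots st (i, s))) \<or>
   (\<exists>i\<in>set items. \<exists>s\<in>set slots. may_bid E slots st (i, s) \<and>
      auction_step E items slots st = place_bid st (i, s))"
proof -
  have "fold (\<lambda>b r. place_bid st b) bs r = r \<and> bs = [] \<or>
      (\<exists>b\<in>set bs. fold (\<lambda>b r. place_bid st b) bs r = place_bid st b)" for bs r
  proof (induction bs arbitrary: r)
    case (Cons b bs)
    from Cons.IH[of "place_bid st b"] show ?case by (cases bs) auto
  qed simp
  from this[of "filter (may_bid E slots st) (List.product items slots)" st]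
  show ?thesis
    unfolding auction_step_def by (auto simp: filter_empty_conv)
qed

text \<open>No price exceeds the number of slots by more than one, so the square of
  \<open>d # slots\<close> has more entries than bids can be placed; \<open>d\<close> merely
  lengthens the counter.\<close>

definition auction :: "('i \<Rightarrow> 's \<Rightarrow> bool) \<Rightarrow> 'i list \<Rightarrow> 's list \<Rightarrow> 's \<Rightarrow> ('i \<times> 's) list" where
  "auction E items slots d = fst (fold (\<lambda>_. auction_step E items slots)
     (List.product (d # slots) (d # slots)) ([], []))"

text \<open>\<open>near_cheapest\<close> is the approximate complementary slackness of auction
  algorithms, with increment one. \<open>priced\<close> reflects that a slot, once bid on, may
  change its owner but is never vacated.\<close>

locale auction_state =
  fixes E :: "'i \<Rightarrow> 's \<Rightarrow> bool" and items :: "'i list" and slots :: "'s list"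
    and M :: "('i \<times> 's) list" and H :: "'s list"
  assumes matched: "(i, s) \<in> set M \<Longrightarrow> i \<in> set items \<and> s \<in> set slots \<and> E i s"
    and slot_unique: "(i, s) \<in> set M \<Longrightarrow> (i, s') \<in> set M \<Longrightarrow> s = s'"
    and owner_unique: "(i, s) \<in> set M \<Longrightarrow> (i', s) \<in> set M \<Longrightarrow> i = i'"
    and priced: "s \<in> set H \<longleftrightarrow> (\<exists>i. (i, s) \<in> set M)"
    and near_cheapest: "(i, s) \<in> set M \<Longrightarrow> s' \<in> set slots \<Longrightarrow> E i s' \<Longrightarrow>
      count_list H s \<le> Suc (count_list H s')"
    and price_bound: "count_list H s \<le> Suc (length slots)"
begin

lemma length_H: "length H < length (List.product (d # slots) (d # slots))"
proof -
  have "set H \<subseteq> set slots"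
    using priced matched by blast
  then have "length H = (\<Sum>s\<in>set slots. count_list H s)"
    by (simp add: sum_count_set)
  also have "\<dots> \<le> card (set slots) * Suc (length slots)"
    using sum_bounded_above[of "set slots" "count_list H" "Suc (length slots)"] price_bound by simp
  also have "\<dots> \<le> length slots * Suc (length slots)"
    by (intro mult_right_mono card_length) simp
  finally show ?thesis
    by (simp add: length_product)
qed

lemma auction_state_bid:
  assumes bid: "may_bid E slots (M, H) (i0, s0)" and "i0 \<in> set items" "s0 \<in> set slots"
  shows "auction_state E items slots (fst (place_bid (M, H) (i0, s0)))
    (snd (place_bid (M, H) (i0, s0)))"
proof -
  have new: "E i0 s0" "\<And>s. (i0, s) \<notin> set M" "count_list H s0 \<le> length slots"
    "\<And>s. s \<in> set slots \<Longrightarrow> E i0 s \<Longrightarrow> count_list H s0 \<le> count_list H s"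
    using bid by (auto simp: may_bid_def longer_def count_list_eq_length_filter not_less image_iff)
  show ?thesis
  proof (unfold_locales, goal_cases)
    case (1 i s)
    then show ?case using matched[of i s] assms(2,3) new(1) by (auto simp: place_bid_def)
  next
    case (2 i s s')
    then show ?case using slot_unique[of i s s'] new(2) by (auto simp: place_bid_def)
  next
    case (3 i s i')
    then show ?case using owner_unique[of i s i'] by (auto simp: place_bid_def)
  next
    case (4 s)
    then show ?case using priced[of s] by (auto simp: place_bid_def)
  next
    \<comment> \<open>The new owner chose a cheapest slot, which is now dearer by one. For the other
      owners the price of their own slot is unchanged, and the alternatives only become
      dearer.\<close>
    case (5 i s s')
    then show ?case using near_cheapest[of i s s'] new(4)[of s'] by (auto simp: place_bid_def)
  next
    case (6 s)
    then show ?case using price_bound[of s] new(3) by (auto simp: place_bid_def)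
  qed
qed

text \<open>There are fewer slots than prices from 0 to the number of slots, so some price \<open>j\<close> in this
  range does not occur. An owner of a slot dearer than \<open>j\<close> and an item priced out of the auction
  see no slot cheaper than \<open>j\<close>, hence only slots dearer than \<open>j\<close>.\<close>

lemma closed_slots:
  assumes stable: "\<And>i s. i \<in> set items \<Longrightarrow> s \<in> set slots \<Longrightarrow> \<not> may_bid E slots (M, H) (i, s)"
  obtains T where "T \<subseteq> set slots" "\<And>s. s \<in> T \<Longrightarrow> \<exists>i. (i, s) \<in> set M"
    "\<And>i s. i \<in> set items \<Longrightarrow> (\<forall>t. (i, t) \<in> set M \<longrightarrow> t \<in> T) \<Longrightarrow> s \<in> set slots \<Longrightarrow> E i s \<Longrightarrow> s \<in> T"
proof -
  have "card (count_list H ` set slots) < card {..length slots}"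
    using card_image_le[of "set slots" "count_list H"] card_length[of slots] by simp
  then have "\<not> {..length slots} \<subseteq> count_list H ` set slots"
    using card_mono[of "count_list H ` set slots" "{..length slots}"] by force
  then obtain j where j: "j \<le> length slots" "j \<notin> count_list H ` set slots"
    by auto
  define T where "T = {s \<in> set slots. j < count_list H s}"
  show thesis
  proof
    show "T \<subseteq> set slots" by (auto simp: T_def)
    show "\<exists>i. (i, s) \<in> set M" if "s \<in> T" for s
      using that priced[of s] by (auto simp: T_def count_list_0_iff[symmetric])
    fix i s
    assume i: "i \<in> set items" "\<forall>t. (i, t) \<in> set M \<longrightarrow> t \<in> T" and s: "s \<in> set slots" "E i s"
    have "j \<le> count_list H s"
    proof (cases "\<exists>t. (i, t) \<in> set M")
      case True
      then obtain t where "(i, t) \<in> set M" by blast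
      with i s near_cheapest[of i t s] show ?thesis by (auto simp: T_def)
    next
      case False
      \<comment> \<open>An unmatched item could bid on its cheapest compatible slot unless even that
        price exceeds the number of slots.\<close>
      define t where "t = arg_min_on (count_list H) {s \<in> set slots. E i s}"
      have t: "t \<in> {s \<in> set slots. E i s}"
        unfolding t_def using s by (intro arg_min_if_finite(1)) auto
      have least: "count_list H t \<le> count_list H s'" if "s' \<in> set slots" "E i s'" for s'
        unfolding t_def using that by (intro arg_min_least) auto
      have "\<not> may_bid E slots (M, H) (i, t)"
        using stable i t by blast
      then have "length slots < count_list H t"
        using t least False
        by (auto simp: may_bid_def longer_def count_list_eq_length_filter not_less image_iff
            dest: leD)
      with least[OF s] j(1) show ?thesis by simp
    qed
    with j(2) s(1) show "s \<in> T"
      by (auto simp: T_def order_less_le)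
  qed
qed

end

lemma auction_state_auction:
  fixes E :: "'i \<Rightarrow> 's \<Rightarrow> bool"
  obtains H where "auction_state E items slots (auction E items slots d) H"
    "\<And>i s. i \<in> set items \<Longrightarrow> s \<in> set slots \<Longrightarrow> \<not> may_bid E slots (auction E items slots d, H) (i, s)"
proof -
  let ?I = "\<lambda>st. auction_state E items slots (fst st) (snd st)"
  let ?\<Phi> = "\<lambda>st :: ('i \<times> 's) list \<times> 's list. length (snd st)"
  let ?f = "auction_step E items slots"
  let ?ts = "List.product (d # slots) (d # slots)"
  have start: "?I ([], [])"
    by unfold_locales auto
  have step: "?I (?f st) \<and> (?f st = st \<or> ?\<Phi> st < ?\<Phi> (?f st))" if "?I st" for st
    using auction_step_cases[of E items slots st]
      auction_state.auction_state_bid[OF that] that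
    by (auto simp: place_bid_def)
  have bound: "?\<Phi> st < length ?ts" if "?I st" for st
    using auction_state.length_H[OF that] .
  define st where "st = fold (\<lambda>_. ?f) ?ts ([], [])"
  have st: "?I st" "?f st = st"
    unfolding st_def by (rule fold_fixpoint[where I = ?I and \<Phi> = ?\<Phi>, OF start step bound]; assumption)+
  have M: "auction E items slots d = fst st"
    by (simp add: auction_def st_def)
  have "\<not> may_bid E slots st (i, s)" if "i \<in> set items" "s \<in> set slots" for i s
  proof -
    \<comment> \<open>Every bid lengthens the list of bids, so a state fixed by
      \<open>auction_step\<close> admits none.\<close>
    have "place_bid st b \<noteq> st" for b
      by (metis length_Cons n_not_Suc_n place_bid_def snd_conv)
    with auction_step_cases[of E items slots st] st(2) that show ?thesis by metis
  qed
  with that[of "snd st"] st(1) show thesis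
    unfolding M by simp
qed


section \<open>Replacing paths through a crown\<close>

definition list_graph :: "'a list \<Rightarrow> ('a \<times> 'a) list \<Rightarrow> 'a graph" where
  "list_graph vs es = (set vs, (\<lambda>(u, v). {u, v}) ` set es)"

lemma edge_list_graph: "{u, v} \<in> edges (list_graph vs es) \<longleftrightarrow> adj es u v"
  by (auto simp: list_graph_def adj_def doubleton_eq_iff image_iff)

lemma P2_verts_path_list: "P2_verts p = set (path_list p)"
  by (cases p) (simp add: P2_verts_def)

lemma is_P2_list_graph:
  "is_P2 (list_graph vs es) p \<longleftrightarrow> path_in es p \<and> set (path_list p) \<subseteq> set vs"
  by (cases p) (auto simp: is_P2_def path_in_def edge_list_graph, auto simp: list_graph_def)

lemma fst_in_P2_verts: "fst p \<in> P2_verts p"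
  by (cases p) (simp add: P2_verts_def)

lemma P2_packing_mono_number:
  assumes "P2_packing G n" "k \<le> n"
  shows "P2_packing G k"
proof -
  obtain Q where Q: "finite Q" "card Q = n" "\<forall>p\<in>Q. is_P2 G p"
    "pairwise (\<lambda>p q. disjnt (P2_verts p) (P2_verts q)) Q"
    using assms(1) unfolding P2_packing_def by blast
  obtain R where R: "R \<subseteq> Q" "card R = k"
    using obtain_subset_with_card_n assms(2) Q(2) by metis
  have "finite R" "\<forall>p\<in>R. is_P2 G p" "pairwise (\<lambda>p q. disjnt (P2_verts p) (P2_verts q)) R"
    using R(1) Q finite_subset pairwise_subset by (blast+)
  with R(2) show ?thesis unfolding P2_packing_def by blast
qed

lemma P2_packing_mono_graph:
  assumes "P2_packing G k" "\<And>p. is_P2 G p \<Longrightarrow> is_P2 G' p"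
  shows "P2_packing G' k"
  using assms unfolding P2_packing_def by metis

lemma P2_packing_covered:
  assumes "distinct (covered P)" "\<And>p. p \<in> set P \<Longrightarrow> is_P2 G p"
  shows "P2_packing G (length P)"
proof -
  have "distinct P \<and> pairwise (\<lambda>p q. disjnt (P2_verts p) (P2_verts q)) (set P)"
    using assms(1)
  proof (induction P)
    case (Cons p P)
    have *: "disjnt (P2_verts p) (P2_verts q)" if "q \<in> set P" for q
      using Cons.prems path_list_subset_covered[OF that]
      by (auto simp: disjnt_def P2_verts_path_list)
    have "p \<notin> set P"
      using *[of p] fst_in_P2_verts[of p] by (auto simp: disjnt_def)
    with Cons * show ?case by (auto simp: pairwise_insert disjnt_sym)
  qed simp
  then show ?thesis
    unfolding P2_packing_def using assms(2) by (intro exI[of _ "set P"]) (auto simp: distinct_card)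
qed

text \<open>A packing has at most one path through each vertex of \<open>S\<close>; those paths are exchanged for
  the paths \<open>R s\<close>.\<close>

lemma P2_packing_crown:
  assumes pk: "P2_packing G k" and S: "finite S"
    and hits: "\<And>p. is_P2 G p \<Longrightarrow> P2_verts p \<inter> Z \<noteq> {} \<Longrightarrow> P2_verts p \<inter> S \<noteq> {}"
    and avoids: "\<And>p. is_P2 G p \<Longrightarrow> P2_verts p \<inter> (S \<union> Z) = {} \<Longrightarrow> is_P2 G' p"
    and R: "\<And>s. s \<in> S \<Longrightarrow> is_P2 G' (R s) \<and> P2_verts (R s) \<subseteq> S \<union> Z"
    and disj: "\<And>s t. s \<in> S \<Longrightarrow> t \<in> S \<Longrightarrow> s \<noteq> t \<Longrightarrow> disjnt (P2_verts (R s)) (P2_verts (R t))"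
  shows "P2_packing G' k"
proof -
  obtain Q where Q: "finite Q" "card Q = k" "\<And>p. p \<in> Q \<Longrightarrow> is_P2 G p"
    "pairwise (\<lambda>p q. disjnt (P2_verts p) (P2_verts q)) Q"
    using pk unfolding P2_packing_def by blast
  define A where "A = {p \<in> Q. P2_verts p \<inter> S \<noteq> {}}"
  have "\<forall>p\<in>A. \<exists>s. s \<in> P2_verts p \<inter> S"
    by (auto simp: A_def)
  then obtain h where h: "\<And>p. p \<in> A \<Longrightarrow> h p \<in> P2_verts p \<inter> S"
    by metis
  have "inj_on h A"
  proof (rule inj_onI, rule ccontr)
    fix p q assume "p \<in> A" "q \<in> A" "h p = h q" "p \<noteq> q"
    with h[of p] h[of q] Q(4) show False
      by (auto simp: A_def pairwise_def disjnt_def)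
  qed
  then have cA: "card A \<le> card S"
    using h S by (intro card_inj_on_le) auto
  have avoid: "P2_verts p \<inter> (S \<union> Z) = {}" if "p \<in> Q - A" for p
  proof -
    have "P2_verts p \<inter> S = {}" using that by (auto simp: A_def)
    with hits[OF Q(3), of p] that show ?thesis by blast
  qed
  have "inj_on R S"
  proof (rule inj_onI, rule ccontr)
    fix s t assume "s \<in> S" "t \<in> S" "R s = R t" "s \<noteq> t"
    with disj[of s t] fst_in_P2_verts[of "R s"] show False by (auto simp: disjnt_def)
  qed
  then have cR: "card (R ` S) = card S" by (rule card_image)
  have cross: "disjnt (P2_verts p) (P2_verts (R s))" if "p \<in> Q - A" "s \<in> S" for p s
    using avoid[OF that(1)] R[OF that(2)] by (auto simp: disjnt_def)
  have "(Q - A) \<inter> R ` S = {}"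
  proof (rule ccontr)
    assume "(Q - A) \<inter> R ` S \<noteq> {}"
    then obtain s where "R s \<in> Q - A" "s \<in> S" by blast
    from cross[OF this] fst_in_P2_verts[of "R s"] show False by (auto simp: disjnt_def)
  qed
  then have "card (Q - A \<union> R ` S) = card (Q - A) + card S"
    using Q(1) S cR by (simp add: card_Un_disjoint)
  moreover have "card (Q - A) = k - card A"
    using Q(1,2) by (subst card_Diff_subset) (auto simp: A_def)
  ultimately have card: "k \<le> card (Q - A \<union> R ` S)"
    using cA by simp
  have "P2_packing G' (card (Q - A \<union> R ` S))"
    unfolding P2_packing_def
  proof (intro exI conjI ballI)
    show "finite (Q - A \<union> R ` S)" using Q(1) S by simp
    show "is_P2 G' p" if "p \<in> Q - A \<union> R ` S" for p
      using that R avoids[OF Q(3) avoid] by blast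
    show "pairwise (\<lambda>p q. disjnt (P2_verts p) (P2_verts q)) (Q - A \<union> R ` S)"
    proof (rule pairwiseI)
      fix p q assume pq: "p \<in> Q - A \<union> R ` S" "q \<in> Q - A \<union> R ` S" "p \<noteq> q"
      consider "p \<in> Q - A" "q \<in> Q - A" | s where "p \<in> Q - A" "q = R s" "s \<in> S"
        | s where "q \<in> Q - A" "p = R s" "s \<in> S"
        | s t where "p = R s" "q = R t" "s \<in> S" "t \<in> S" "s \<noteq> t"
        using pq by blast
      then show "disjnt (P2_verts p) (P2_verts q)"
      proof cases
        case 1
        then show ?thesis using Q(4) pq(3) by (auto simp: pairwise_def)
      qed (use cross disj disjnt_sym in blast)+
    qed
  qed simp
  with card show ?thesis by (rule P2_packing_mono_number[rotated])
qed


section \<open>The kernel\<close>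

definition isolated_list :: "'a list \<Rightarrow> ('a \<times> 'a) list \<Rightarrow> ('a \<times> 'a \<times> 'a) list \<Rightarrow> 'a list" where
  "isolated_list vs es P = filter (\<lambda>x. x \<notin> set (covered P) \<and>
     (\<forall>e\<in>set (free_edges es P). x \<noteq> fst e \<and> x \<noteq> snd e)) vs"

text \<open>An isolated vertex \<open>x\<close> outside the packing is the item \<open>(x, x)\<close>. A vertex of the packing has
  the slots 0 and 1 for isolated vertices and the slot 2 for edges.\<close>

definition crown_items :: "'a list \<Rightarrow> ('a \<times> 'a) list \<Rightarrow> ('a \<times> 'a \<times> 'a) list \<Rightarrow> ('a \<times> 'a) list" where
  "crown_items vs es P = free_edges es P @ map (\<lambda>x. (x, x)) (isolated_list vs es P)"

definition crown_slots :: "('a \<times> 'a \<times> 'a) list \<Rightarrow> ('a \<times> nat) list" where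
  "crown_slots P = List.product (covered P) [0, 1, 2]"

text \<open>The equation between truth values keeps the two kinds of items on their own slots, so
  one auction solves both matching problems at once.\<close>

definition compatible :: "('a \<times> 'a) list \<Rightarrow> 'a \<times> 'a \<Rightarrow> 'a \<times> nat \<Rightarrow> bool" where
  "compatible es i s \<longleftrightarrow> (adj es (fst i) (fst s) \<or> adj es (snd i) (fst s)) \<and>
     (fst i = snd i) = (snd s \<noteq> 2)"

definition kept :: "('a \<times> 'a \<times> 'a) list \<Rightarrow> (('a \<times> 'a) \<times> 'a \<times> nat) list \<Rightarrow> 'a \<Rightarrow> bool" where
  "kept P M x \<longleftrightarrow> x \<in> set (covered P) \<or> (\<exists>b\<in>set M. x = fst (fst b) \<or> x = snd (fst b))"

definition kept_edges ::
    "('a \<times> 'a \<times> 'a) list \<Rightarrow> (('a \<times> 'a) \<times> 'a \<times> nat) list \<Rightarrow> ('a \<times> 'a) list \<Rightarrow> ('a \<times> 'a) list" where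
  "kept_edges P M es = filter (\<lambda>e. kept P M (fst e) \<and> kept P M (snd e)) es"

lemma adj_kept_edges: "adj (kept_edges P M es) u v \<longleftrightarrow> adj es u v \<and> kept P M u \<and> kept P M v"
  by (auto simp: adj_def kept_edges_def)

locale packing_with_matching = optimal_packing vs es P +
  auction_state "compatible es" "crown_items vs es P" "crown_slots P" M H
  for vs :: "'a list" and es P M H +
  assumes no_bid: "i \<in> set (crown_items vs es P) \<Longrightarrow> s \<in> set (crown_slots P) \<Longrightarrow>
    \<not> may_bid (compatible es) (crown_slots P) (M, H) (i, s)"
begin

abbreviation "\<I> \<equiv> set (crown_items vs es P)"

abbreviation ends :: "'a \<times> 'a \<Rightarrow> 'a set" where "ends i \<equiv> {fst i, snd i}"

section \<open>Vertices outside the packing\<close>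

lemma isolated_list: "set (isolated_list vs es P) = isolated"
  by (fastforce simp: isolated_list_def isolated_def free_def free_edges_def adj_def dest: edge_in)

lemma item_cases:
  assumes "i \<in> \<I>"
  obtains x where "i = (x, x)" "x \<in> isolated"
  | a b where "i = (a, b)" "a \<noteq> b" "adj es a b" "a \<in> free" "b \<in> free"
proof -
  have "i \<in> set (free_edges es P) \<or> (\<exists>x\<in>isolated. i = (x, x))"
    using assms by (auto simp: crown_items_def isolated_list)
  then show thesis
  proof
    assume i: "i \<in> set (free_edges es P)"
    obtain a b where ab: "i = (a, b)" by (cases i)
    with i have "(a, b) \<in> set es" "a \<notin> set (covered P)" "b \<notin> set (covered P)"
      by (auto simp: free_edges_def)
    with edge_in[of a b] show thesis
      by (intro that(2)[OF ab]) (auto simp: adj_def free_def)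
  qed (use that(1) in blast)
qed

lemma item_free: "i \<in> \<I> \<Longrightarrow> ends i \<subseteq> free"
  by (erule item_cases) (auto simp: isolated_def)

lemma single_item: "i \<in> \<I> \<Longrightarrow> fst i = snd i \<Longrightarrow> fst i \<in> isolated"
  by (erule item_cases) auto

lemma edge_item: "i \<in> \<I> \<Longrightarrow> fst i \<noteq> snd i \<Longrightarrow> adj es (fst i) (snd i)"
  by (erule item_cases) auto

lemma free_in_item:
  assumes "x \<in> free"
  obtains i where "i \<in> \<I>" "x \<in> ends i"
proof (cases "x \<in> isolated")
  case True
  then have "(x, x) \<in> \<I>" by (simp add: crown_items_def isolated_list)
  with that show ?thesis by fastforce
next
  case False
  then obtain y where "adj es x y" "y \<notin> set (covered P)"
    using assms by (auto simp: isolated_def)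
  then have "(x, y) \<in> \<I> \<or> (y, x) \<in> \<I>"
    using assms by (auto simp: crown_items_def free_edges_def adj_def free_def)
  with that show ?thesis by fastforce
qed

lemma no_two_free_neighbours:
  assumes "adj es x y" "adj es x z" "x \<in> free" "y \<in> free" "z \<in> free"
  shows "y = z"
proof (rule ccontr)
  assume "y \<noteq> z"
  then have "path_in es (y, x, z)"
    using assms adj_in[OF assms(1)] adj_in[OF assms(2)] by (auto simp: path_in_def adj_commute)
  from no_free_path[OF this] assms(3-5) show False by simp
qed

text \<open>Two edges outside the packing with one common end form a free path, and an isolated
  vertex lies on no such edge. The reversed copy of an edge is excluded by
  \<open>edge_once\<close>.\<close>

lemma items_disjoint:
  assumes "i \<in> \<I>" "i' \<in> \<I>" "x \<in> ends i" "x \<in> ends i'"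
  shows "i = i'"
proof (cases "fst i = snd i \<or> fst i' = snd i'")
  case True
  then have x: "x \<in> isolated" using assms single_item[of i] single_item[of i'] by auto
  have "fst j = snd j" if "j \<in> \<I>" "x \<in> ends j" for j
  proof (rule ccontr)
    assume "fst j \<noteq> snd j"
    then have "adj es (fst j) (snd j)" "adj es (snd j) (fst j)"
      using edge_item[OF that(1)] adj_commute by metis+
    moreover have "fst j \<notin> set (covered P)" "snd j \<notin> set (covered P)"
      using item_free[OF that(1)] by (auto simp: free_def)
    ultimately show False using x that(2) by (auto simp: isolated_def)
  qed
  with assms have "fst i = snd i" "fst i' = snd i'" by blast+
  with assms show ?thesis by (auto simp: prod_eq_iff)
next
  case False
  then have e: "i \<in> set es" "i' \<in> set es"
    using assms(1,2) by (auto simp: crown_items_def free_edges_def)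
  have adj: "adj es (fst i) (snd i)" "adj es (snd i) (fst i)"
    "adj es (fst i') (snd i')" "adj es (snd i') (fst i')"
    using e by (auto simp: adj_def)
  have fr: "fst i \<in> free" "snd i \<in> free" "fst i' \<in> free" "snd i' \<in> free"
    using item_free assms(1,2) by blast+
  have "ends i = ends i'"
    using no_two_free_neighbours[of x] assms(3,4) adj fr by auto
  then have "i = i' \<or> i = (snd i', fst i')"
    by (cases i; cases i') (auto simp: doubleton_eq_iff)
  with e edge_once[of "fst i'" "snd i'"] show ?thesis by auto
qed

lemma owned: "(i, (x, c)) \<in> set M \<Longrightarrow> i \<in> \<I> \<and> x \<in> set (covered P) \<and> c \<le> 2 \<and>
    (adj es (fst i) x \<or> adj es (snd i) x) \<and> (fst i = snd i) = (c \<noteq> 2)"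
  using matched[of i "(x, c)"] by (auto simp: crown_slots_def compatible_def)

subsection \<open>The number of remaining vertices\<close>

text \<open>Each vertex has only one slot 2, so two matched edges would hang on different vertices
  of \<open>L\<close>. Each edge forms a path with its vertex, and these two paths could replace
  \<open>L\<close>.\<close>

lemma edge_slot_unique:
  assumes L: "L \<in> set P" "x \<in> set (path_list L)" "x' \<in> set (path_list L)"
    and M: "(i, (x, 2)) \<in> set M" "(i', (x', 2)) \<in> set M"
  shows "i = i'"
proof (rule ccontr)
  assume ne: "i \<noteq> i'"
  then have x: "x \<noteq> x'" using owner_unique M by blast
  have path: "\<exists>A. path_in es A \<and> set (path_list A) = {x} \<union> ends i"
    if "(i, (x, 2)) \<in> set M" for i x
  proof -
    note o = owned[OF that]
    have *: "fst i \<noteq> snd i" "adj es (fst i) (snd i)" "adj es (snd i) (fst i)"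
      "x \<notin> ends i"
      using o edge_item[of i] adj_commute[of es] item_free[of i] by (auto simp: free_def)
    from o consider "adj es (fst i) x" | "adj es (snd i) x" by blast
    then show ?thesis
    proof cases
      case 1
      with * show ?thesis
        by (intro exI[of _ "(x, fst i, snd i)"])
          (auto simp: path_in_def adj_commute simp del: prod.collapse)
    next
      case 2
      with * show ?thesis
        by (intro exI[of _ "(x, snd i, fst i)"]) (auto simp: path_in_def adj_commute)
    qed
  qed
  obtain A B where A: "path_in es A" "set (path_list A) = {x} \<union> ends i"
    and B: "path_in es B" "set (path_list B) = {x'} \<union> ends i'"
    using path M by metis
  have I: "i \<in> \<I>" "i' \<in> \<I>" using owned M by blast+
  have cov: "x \<in> set (covered P)" "x' \<in> set (covered P)" using owned M by blast+
  have fr: "ends i \<subseteq> free" "ends i' \<subseteq> free" using I item_free by blast+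
  have "ends i \<inter> ends i' = {}" using items_disjoint[OF I] ne by blast
  moreover have "x \<notin> ends i'" "x' \<notin> ends i" using cov fr by (auto simp: free_def)
  ultimately have "set (path_list A) \<inter> set (path_list B) = {}"
    unfolding A(2) B(2) using x by auto
  moreover have "set (path_list A) \<subseteq> set (path_list L) \<union> free"
    "set (path_list B) \<subseteq> set (path_list L) \<union> free"
    unfolding A(2) B(2) using fr L by auto
  ultimately show False using no_augmentation[OF L(1) A(1) B(1)] by blast
qed

text \<open>Let \<open>a\<close> and \<open>b\<close> hang on different vertices of
  \<open>L = (u, v, w)\<close>. If these are \<open>u\<close> and \<open>w\<close>, the path
  \<open>a, u, v\<close> releases \<open>w\<close> and the edge \<open>wb\<close>. If one of them is
  \<open>v\<close>, the path formed by its isolated neighbour, \<open>v\<close> and the remaining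
  end releases the other end with its edge. Both contradict \<open>no_exchange\<close>.\<close>

lemma single_slot_unique:
  assumes L: "L \<in> set P" "x \<in> set (path_list L)" "x' \<in> set (path_list L)"
    and M: "(i, (x, c)) \<in> set M" "(i', (x', c')) \<in> set M" "c \<noteq> 2" "c' \<noteq> 2"
  shows "x = x'"
proof (rule ccontr)
  assume x: "x \<noteq> x'"
  then have ne: "i \<noteq> i'" using slot_unique M by blast
  obtain u v w where uvw: "L = (u, v, w)" by (cases L)
  have Lp: "distinct [u, v, w]" "adj es u v" "adj es v w" "adj es v u" "adj es w v"
    using path_in_P[OF L(1)] by (auto simp: uvw path_in_def adj_commute)
  define a where "a = fst i"
  define b where "b = fst i'"
  have I: "i \<in> \<I>" "i' \<in> \<I>" "fst i = snd i" "fst i' = snd i'" using owned M by blast+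
  have a: "a \<in> isolated" and b: "b \<in> isolated" using single_item I by (auto simp: a_def b_def)
  have ab: "a \<noteq> b" using ne I by (auto simp: a_def b_def prod_eq_iff)
  have adj: "adj es a x" "adj es b x'" "adj es x a" "adj es x' b"
    using owned[OF M(1)] owned[OF M(2)] I by (auto simp: a_def b_def adj_commute)
  have "set (path_list L) \<subseteq> set (covered P)" using path_list_subset_covered L(1) by blast
  then have out: "a \<notin> {u, v, w}" "b \<notin> {u, v, w}"
    using a b by (auto simp: isolated_def free_def uvw)
  \<comment> \<open>In the instances below the middle vertex \<open>q\<close> comes first, then the
    ends \<open>p\<close> and \<open>r\<close>, then the released vertex \<open>y\<close> and its
    isolated neighbour \<open>z\<close>.\<close>
  have ex: False if "adj es q p" "adj es q r" "distinct [p, q, r, y, z]" "adj es y z"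
    "{p, q, r} \<subseteq> {u, v, w} \<union> isolated" "y \<in> {u, v, w}" "z \<in> isolated" for p q r y z
    using no_exchange[OF L(1), of "(p, q, r)" y z] that by (auto simp: uvw path_in_def adj_commute)
  have "x \<in> {u, v, w}" "x' \<in> {u, v, w}" using L by (auto simp: uvw)
  then consider "x = u" "x' = w" | "x = w" "x' = u" | "x = u" "x' = v" | "x = v" "x' = u"
    | "x = w" "x' = v" | "x = v" "x' = w"
    using x by auto
  then show False
  proof cases
    case 1
    then show ?thesis using ex[of u a v w b] Lp adj a b ab out by auto
  next
    case 2
    then show ?thesis using ex[of u b v w a] Lp adj a b ab out by auto
  next
    case 3
    then show ?thesis using ex[of v b w u a] Lp adj a b ab out by auto
  next
    case 4
    then show ?thesis using ex[of v a w u b] Lp adj a b ab out by auto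
  next
    case 5
    then show ?thesis using ex[of v b u w a] Lp adj a b ab out by auto
  next
    case 6
    then show ?thesis using ex[of v a u w b] Lp adj a b ab out by auto
  qed
qed

definition assigned :: "'a \<times> 'a \<times> 'a \<Rightarrow> 'a set" where
  "assigned L = {y. \<exists>i x c. (i, (x, c)) \<in> set M \<and> x \<in> set (path_list L) \<and> y \<in> ends i}"

lemma finite_assigned: "finite (assigned L)"
proof (rule finite_subset)
  show "assigned L \<subseteq> (\<Union>b\<in>set M. ends (fst b))"
  proof
    fix y assume "y \<in> assigned L"
    then obtain i s where "(i, s) \<in> set M" "y \<in> ends i" unfolding assigned_def by blast
    then show "y \<in> (\<Union>b\<in>set M. ends (fst b))" by (intro UN_I[of "(i, s)"]) auto
  qed
qed simp

lemma card_assigned: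
  assumes L: "L \<in> set P"
  shows "card (assigned L) \<le> 4"
proof -
  define A where "A = {y. \<exists>i x. (i, (x, 2)) \<in> set M \<and> x \<in> set (path_list L) \<and> y \<in> ends i}"
  define B where "B = {b \<in> set M. fst (snd b) \<in> set (path_list L) \<and> snd (snd b) \<noteq> 2}"
  have A: "card A \<le> 2"
  proof (cases "A = {}")
    case False
    then obtain i x where "(i, (x, 2)) \<in> set M" "x \<in> set (path_list L)" by (auto simp: A_def)
    then have "i' = i" if "(i', (x', 2)) \<in> set M" "x' \<in> set (path_list L)" for i' x'
      using edge_slot_unique[OF L] that by blast
    then have "A \<subseteq> ends i" unfolding A_def by blast
    then have "card A \<le> card (ends i)" by (intro card_mono) auto
    also have "\<dots> \<le> 2" by (simp add: card_insert_if)
    finally show ?thesis .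
  qed simp
  have B: "card B \<le> 2"
  proof (cases "B = {}")
    case False
    then obtain i x c where x: "(i, (x, c)) \<in> set M" "x \<in> set (path_list L)" "c \<noteq> 2"
      by (auto simp: B_def)
    have "snd b \<in> {(x, 0), (x, 1)}" if "b \<in> B" for b
    proof -
      obtain i' x' c' where b: "b = (i', (x', c'))" by (metis prod.exhaust)
      with that have *: "(i', (x', c')) \<in> set M" "x' \<in> set (path_list L)" "c' \<noteq> 2"
        by (auto simp: B_def)
      have "x = x'" using single_slot_unique[OF L x(2) *(2) x(1) *(1) x(3) *(3)] .
      with owned[OF *(1)] *(3) show ?thesis by (auto simp: b)
    qed
    then have "snd ` B \<subseteq> {(x, 0), (x, 1)}" by blast
    \<comment> \<open>Slots have unique owners, so the two slots left at \<open>x\<close> bound the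
      number of matched pairs in \<open>B\<close>.\<close>
    moreover have "inj_on snd B"
      using owner_unique by (auto simp: inj_on_def B_def)
    ultimately have "card B \<le> card {(x, 0 :: nat), (x, 1)}"
      by (intro card_inj_on_le) auto
    then show ?thesis by simp
  qed simp
  have fin: "finite B" by (simp add: B_def)
  have "assigned L \<subseteq> A \<union> (\<lambda>b. fst (fst b)) ` B"
  proof
    fix y assume "y \<in> assigned L"
    then obtain i x c where y: "(i, (x, c)) \<in> set M" "x \<in> set (path_list L)" "y \<in> ends i"
      unfolding assigned_def by blast
    show "y \<in> A \<union> (\<lambda>b. fst (fst b)) ` B"
    proof (cases "c = 2")
      case True
      with y show ?thesis unfolding A_def by blast
    next
      case False
      with owned[OF y(1)] y have "(i, (x, c)) \<in> B" "y = fst (fst (i, (x, c)))" by (auto simp: B_def)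
      then show ?thesis by blast
    qed
  qed
  moreover have "A \<subseteq> assigned L"
    unfolding A_def assigned_def by blast
  then have "finite A" using finite_assigned by (rule finite_subset)
  ultimately have "card (assigned L) \<le> card (A \<union> (\<lambda>b. fst (fst b)) ` B)"
    using fin by (intro card_mono) auto
  also have "\<dots> \<le> card A + card B"
    using card_Un_le[of A] card_image_le[OF fin] by (meson add_left_mono order_trans)
  finally show ?thesis using A B by simp
qed

lemma card_kept: "card {x \<in> set vs. kept P M x} \<le> 7 * length P"
proof -
  have "{x \<in> set vs. kept P M x} \<subseteq> (\<Union>L\<in>set P. set (path_list L) \<union> assigned L)"
  proof
    fix y assume "y \<in> {x \<in> set vs. kept P M x}"
    then consider "y \<in> set (covered P)" | i x c where "(i, (x, c)) \<in> set M" "y \<in> ends i"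
      by (auto simp: kept_def)
    then show "y \<in> (\<Union>L\<in>set P. set (path_list L) \<union> assigned L)"
    proof cases
      case 1
      then show ?thesis by (auto simp: covered_def)
    next
      case 2
      then obtain L where "L \<in> set P" "x \<in> set (path_list L)"
        using owned[OF 2(1)] by (auto simp: covered_def)
      with 2 show ?thesis unfolding assigned_def by blast
    qed
  qed
  then have "card {x \<in> set vs. kept P M x} \<le>
      card (\<Union>L\<in>set P. set (path_list L) \<union> assigned L)"
    using finite_assigned by (intro card_mono) auto
  also have "\<dots> \<le> (\<Sum>L\<in>set P. card (set (path_list L) \<union> assigned L))"
    by (rule card_UN_le) simp
  also have "\<dots> \<le> (\<Sum>L\<in>set P. 7)"
  proof (rule sum_mono)
    fix L assume "L \<in> set P"
    then show "card (set (path_list L) \<union> assigned L) \<le> 7"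
      using card_Un_le[of "set (path_list L)" "assigned L"] card_assigned
        card_length[of "path_list L"] by (fastforce simp: path_list_def)
  qed
  also have "\<dots> \<le> 7 * length P"
    using card_length[of P] by simp
  finally show ?thesis .
qed

subsection \<open>Equivalence with the input\<close>

abbreviation "G \<equiv> list_graph vs es"
abbreviation "G' \<equiv> list_graph (filter (kept P M) vs) (kept_edges P M es)"

lemma path_in_kept: "path_in (kept_edges P M es) p \<longleftrightarrow>
    path_in es p \<and> (\<forall>x\<in>set (path_list p). kept P M x)"
  by (auto simp: path_in_def adj_kept_edges path_list_def)

lemma is_P2_kernel: "is_P2 G' p \<longleftrightarrow> is_P2 G p \<and> (\<forall>x\<in>set (path_list p). kept P M x)"
  unfolding is_P2_list_graph path_in_kept by auto

lemma is_P2_kernelI: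
  "path_in es p \<Longrightarrow> (\<And>x. x \<in> set (path_list p) \<Longrightarrow> kept P M x) \<Longrightarrow> is_P2 G' p"
  using path_in_verts[of p] unfolding is_P2_list_graph path_in_kept by auto

lemma kept_owner: "(i, s) \<in> set M \<Longrightarrow> y \<in> ends i \<Longrightarrow> kept P M y"
  by (force simp: kept_def)

lemma kept_covered: "x \<in> set (covered P) \<Longrightarrow> kept P M x"
  by (simp add: kept_def)

text \<open>The crown has head \<open>S\<close> and body \<open>Z\<close>. The body contains all
  deleted vertices, but also the kept items that own slots in \<open>T\<close>; out of these every
  vertex of \<open>S\<close> receives a path of its own, onto which a packing of the input is
  rerouted.\<close>

lemma P2_packing_kernel: "P2_packing G k \<longleftrightarrow> P2_packing G' k"
proof
  assume "P2_packing G' k"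
  then show "P2_packing G k"
    by (rule P2_packing_mono_graph) (simp add: is_P2_kernel)
next
  assume pk: "P2_packing G k"
  obtain T where T: "T \<subseteq> set (crown_slots P)" "\<And>s. s \<in> T \<Longrightarrow> \<exists>i. (i, s) \<in> set M"
    "\<And>i s. i \<in> \<I> \<Longrightarrow> (\<forall>t. (i, t) \<in> set M \<longrightarrow> t \<in> T) \<Longrightarrow> s \<in> set (crown_slots P) \<Longrightarrow>
      compatible es i s \<Longrightarrow> s \<in> T"
    using closed_slots[OF no_bid] by metis
  \<comment> \<open>Unmatched items belong to \<open>C\<close> vacuously.\<close>
  define C where "C = {i \<in> \<I>. \<forall>t. (i, t) \<in> set M \<longrightarrow> t \<in> T}"
  define Z where "Z = (\<Union>i\<in>C. ends i)"
  define S where "S = {x \<in> set (covered P). \<exists>z\<in>Z. adj es z x}"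
  have owner_C: "i \<in> C" if "(i, t) \<in> set M" "t \<in> T" for i t
    unfolding C_def using matched[OF that(1)] slot_unique[OF that(1)] that(2) by blast
  have Z_free: "Z \<subseteq> free"
    using item_free by (auto simp: Z_def C_def)
  \<comment> \<open>Items are disjoint, so an edge leaves an item only towards the packing, and from
    an item of \<open>C\<close> it then ends in \<open>S\<close>.\<close>
  have neighbour: "y \<in> ends i" if "i \<in> C" "z \<in> ends i" "adj es z y" "y \<notin> S" for i y z
  proof -
    have z: "z \<in> Z" "z \<in> free" using that(1,2) Z_free by (auto simp: Z_def)
    then have y: "y \<in> free"
      using that(3,4) adj_in[OF that(3)] by (auto simp: S_def free_def)
    then have "(z, y) \<in> \<I> \<or> (y, z) \<in> \<I>"
      using that(3) z(2) by (auto simp: crown_items_def free_edges_def adj_def free_def)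
    then obtain i' where i': "i' \<in> \<I>" "z \<in> ends i'" "y \<in> ends i'" by fastforce
    have "i \<in> \<I>" using that(1) by (simp add: C_def)
    from items_disjoint[OF this i'(1) that(2) i'(2)] i'(3) show ?thesis by simp
  qed
  have hits: "P2_verts p \<inter> S \<noteq> {}" if p: "is_P2 G p" "P2_verts p \<inter> Z \<noteq> {}" for p
  proof
    assume S: "P2_verts p \<inter> S = {}"
    obtain u v w where uvw: "p = (u, v, w)" by (cases p)
    have pp: "distinct [u, v, w]" "adj es u v" "adj es v w" "adj es v u" "adj es w v"
      using p(1) by (auto simp: uvw is_P2_list_graph path_in_def adj_commute)
    have S': "u \<notin> S" "v \<notin> S" "w \<notin> S" using S by (auto simp: uvw P2_verts_def)
    obtain z i where i: "z \<in> {u, v, w}" "i \<in> C" "z \<in> ends i"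
      using p(2) by (auto simp: uvw P2_verts_def Z_def)
    \<comment> \<open>A path that avoids \<open>S\<close> cannot leave the item it meets, but three
      vertices do not fit into two ends.\<close>
    then have "v \<in> ends i"
      using neighbour[OF i(2,3), of v] pp S' by blast
    then have "{u, v, w} \<subseteq> ends i"
      using neighbour[OF i(2), of v] pp S' by blast
    then have "card {u, v, w} \<le> card (ends i)"
      by (intro card_mono) auto
    also have "\<dots> \<le> 2" by (simp add: card_insert_if)
    finally show False using pp(1) by simp
  qed
  have avoids: "is_P2 G' p" if p: "is_P2 G p" "P2_verts p \<inter> (S \<union> Z) = {}" for p
    unfolding is_P2_kernel
  proof (intro conjI ballI p(1))
    fix x assume x: "x \<in> set (path_list p)"
    then have xZ: "x \<notin> Z" using p(2) by (auto simp: P2_verts_path_list)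
    show "kept P M x"
    proof (cases "x \<in> set (covered P)")
      case False
      \<comment> \<open>A free vertex outside \<open>Z\<close> belongs to an item outside
        \<open>C\<close>, which is matched and hence kept.\<close>
      then have "x \<in> free" using x p(1) by (auto simp: free_def is_P2_list_graph)
      then obtain i where i: "i \<in> \<I>" "x \<in> ends i" by (rule free_in_item)
      then have "i \<notin> C" using xZ by (auto simp: Z_def)
      then obtain t where "(i, t) \<in> set M" using i(1) by (auto simp: C_def)
      then show ?thesis using i(2) by (rule kept_owner)
    qed (rule kept_covered)
  qed
  have "\<exists>r. is_P2 G' r \<and> (\<forall>y\<in>P2_verts r. y = x \<or> (\<exists>i c. (i, (x, c)) \<in> set M \<and> i \<in> C \<and> y \<in> ends i))"
    if x: "x \<in> S" for x
  proof -
    \<comment> \<open>\<open>near\<close> records that the path at \<open>x\<close> uses only items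
      owning a slot of \<open>x\<close>. An item owns at most one slot, so the paths of different
      head vertices will be disjoint.\<close>
    define near where
      "near y \<longleftrightarrow> y = x \<or> (\<exists>i c. (i, (x, c)) \<in> set M \<and> i \<in> C \<and> y \<in> ends i)" for y
    have cov: "x \<in> set (covered P)" using x by (simp add: S_def)
    obtain i z where i: "i \<in> C" "z \<in> ends i" "adj es z x"
      using x by (auto simp: S_def Z_def)
    \<comment> \<open>A single item of \<open>C\<close> next to \<open>x\<close> brings all slots of
      its kind at \<open>x\<close> into \<open>T\<close>, where each is owned by an item of
      \<open>C\<close>. Thus one isolated neighbour fills both slots 0 and 1.\<close>
    have own: "\<exists>j. (j, (x, c)) \<in> set M \<and> j \<in> C" if "c \<le> 2" "(fst i = snd i) = (c \<noteq> 2)" for c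
    proof -
      have "c = 0 \<or> c = 1 \<or> c = 2" using that(1) by auto
      then have "(x, c) \<in> set (crown_slots P)" using cov by (auto simp: crown_slots_def)
      moreover have "compatible es i (x, c)" using i that(2) by (auto simp: compatible_def)
      ultimately have "(x, c) \<in> T" using T(3)[of i] i(1) by (auto simp: C_def)
      with T(2) owner_C show ?thesis by blast
    qed
    show ?thesis
    proof (cases "fst i = snd i")
      case True
      obtain j j' where j: "(j, (x, 0)) \<in> set M" "j \<in> C" "(j', (x, 1)) \<in> set M" "j' \<in> C"
        using own[of 0] own[of 1] True by auto
      note o = owned[OF j(1)] owned[OF j(3)]
      have "j \<noteq> j'" using slot_unique[of j "(x, 0)" "(x, 1)"] j by auto
      then have ne: "fst j \<noteq> fst j'" using o by (auto simp: prod_eq_iff)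
      have adj: "adj es (fst j) x" "adj es x (fst j')" using o adj_commute[of es] by auto
      then have p: "path_in es (fst j, x, fst j')"
        using ne adj_in by (auto simp: path_in_def)
      have "is_P2 G' (fst j, x, fst j')"
        using p kept_covered[OF cov] kept_owner[OF j(1)] kept_owner[OF j(3)]
        by (intro is_P2_kernelI) auto
      moreover have "near (fst j)" "near (fst j')" "near x"
        using j unfolding near_def by blast+
      ultimately show ?thesis
        unfolding near_def[symmetric]
        by (intro exI[of _ "(fst j, x, fst j')"]) (simp add: P2_verts_def)
    next
      case False
      obtain j where j: "(j, (x, 2)) \<in> set M" "j \<in> C"
        using own[of 2] False by auto
      note o = owned[OF j(1)]
      have e: "fst j \<noteq> snd j" "adj es (fst j) (snd j)" "adj es (snd j) (fst j)"
        using o edge_item[of j] adj_commute[of es] by auto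
      obtain a b where ab: "ends j = {a, b}" "a \<noteq> b" "adj es a b" "adj es b x"
      proof (cases "adj es (snd j) x")
        case True
        with e show ?thesis by (intro that[of "fst j" "snd j"]) auto
      next
        case False
        with e o show ?thesis by (intro that[of "snd j" "fst j"]) auto
      qed
      then have p: "path_in es (a, b, x)"
        using cov item_free[of j] o by (auto simp: path_in_def free_def)
      have "is_P2 G' (a, b, x)"
        using p kept_covered[OF cov] kept_owner[OF j(1)] ab(1)
        by (intro is_P2_kernelI) auto
      moreover have "near a" "near b" "near x"
        using j ab(1) unfolding near_def by blast+
      ultimately show ?thesis
        unfolding near_def[symmetric]
        by (intro exI[of _ "(a, b, x)"]) (simp add: P2_verts_def)
    qed
  qed
  then obtain R where R: "\<And>x. x \<in> S \<Longrightarrow> is_P2 G' (R x)"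
    "\<And>x y. x \<in> S \<Longrightarrow> y \<in> P2_verts (R x) \<Longrightarrow>
       y = x \<or> (\<exists>i c. (i, (x, c)) \<in> set M \<and> i \<in> C \<and> y \<in> ends i)"
    by metis
  have R_sub: "P2_verts (R x) \<subseteq> S \<union> Z" if "x \<in> S" for x
    using R(2)[OF that] that unfolding Z_def by blast
  have R_disj: "disjnt (P2_verts (R x)) (P2_verts (R x'))"
    if x: "x \<in> S" "x' \<in> S" "x \<noteq> x'" for x x'
  proof (rule ccontr)
    assume "\<not> ?thesis"
    then obtain y where y: "y \<in> P2_verts (R x)" "y \<in> P2_verts (R x')" by (auto simp: disjnt_def)
    have cov: "x \<notin> free" "x' \<notin> free" using x by (auto simp: S_def free_def)
    have "ends i \<subseteq> free" if "i \<in> C" for i using that item_free by (auto simp: C_def)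
    with R(2)[OF x(1) y(1)] R(2)[OF x(2) y(2)] x(3) cov
    obtain i i' c c' where i: "(i, (x, c)) \<in> set M" "(i', (x', c')) \<in> set M"
      "i \<in> C" "i' \<in> C" "y \<in> ends i" "y \<in> ends i'"
      by blast
    then have "i = i'" using items_disjoint by (auto simp: C_def)
    with i slot_unique[of i "(x, c)" "(x', c')"] x(3) show False by simp
  qed
  have finS: "finite S" by (simp add: S_def)
  show "P2_packing G' k"
    by (rule P2_packing_crown[OF pk finS hits avoids _ R_disj]) (use R(1) R_sub in auto)
qed

end


definition kernel_matching ::
    "nat list \<Rightarrow> (nat \<times> nat) list \<Rightarrow> (nat \<times> nat \<times> nat) list \<Rightarrow> ((nat \<times> nat) \<times> nat \<times> nat) list" where
  "kernel_matching vs es P =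
     auction (compatible es) (crown_items vs es P) (crown_slots P) (0, 0)"

text \<open>A large packing settles the instance, and the empty graph with parameter 0 serves as the
  fixed yes-instance.\<close>

definition kernelize :: "nat list \<times> (nat \<times> nat) list \<times> nat \<Rightarrow> nat list \<times> (nat \<times> nat) list \<times> nat" where
  "kernelize = (\<lambda>(vs, es, k). let P = local_packing vs es; M = kernel_matching vs es P in
     if k \<le> length P then ([], [], 0) else (filter (kept P M) vs, kept_edges P M es, k))"

lemma kernelize_correct:
  fixes vs :: "nat list"
  assumes G: "finite_simple_graph (list_graph vs es)" and vs: "distinct vs"
    and es: "distinct (map (\<lambda>(u, v). {u, v}) es)"
    and out: "kernelize (vs, es, k) = (vs', es', k')"
  shows "finite_simple_graph (list_graph vs' es')" "distinct vs'"
    "distinct (map (\<lambda>(u, v). {u, v}) es')" "k' \<le> k" "length vs' \<le> 7 * k"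
    "P2_packing (list_graph vs es) k \<longleftrightarrow> P2_packing (list_graph vs' es') k'"
proof -
  define P where "P = local_packing vs es"
  define M where "M = kernel_matching vs es P"
  have edge_in: "u \<noteq> v \<and> u \<in> set vs \<and> v \<in> set vs" if "(u, v) \<in> set es" for u v
  proof -
    have "{u, v} \<in> edges (list_graph vs es)"
      using that by (auto simp: edge_list_graph adj_def)
    then have "{u, v} \<subseteq> set vs" "card {u, v} = 2"
      using G by (auto simp: finite_simple_graph_def list_graph_def)
    then show ?thesis by (auto simp: card_insert_if split: if_splits)
  qed
  have edge_once: "(v, u) \<notin> set es" if "(u, v) \<in> set es" for u v
  proof
    assume "(v, u) \<in> set es"
    then have "(u, v) = (v, u)"
      using es that by (auto simp: distinct_map dest!: inj_onD[of _ "set es" "(u, v)" "(v, u)"])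
    with edge_in[OF that] show False by simp
  qed
  obtain H where H: "auction_state (compatible es) (crown_items vs es P) (crown_slots P) M H"
    "\<And>i s. i \<in> set (crown_items vs es P) \<Longrightarrow> s \<in> set (crown_slots P) \<Longrightarrow>
      \<not> may_bid (compatible es) (crown_slots P) (M, H) (i, s)"
    unfolding M_def kernel_matching_def by (rule auction_state_auction) blast
  interpret optimal_packing vs es P
    by unfold_locales (use edge_in edge_once locally_optimal_local_packing in \<open>auto simp: P_def\<close>)
  interpret packing_with_matching vs es P M H
    using H by (intro_locales) (auto simp: packing_with_matching_axioms_def auction_state_def)
  have kernelize: "kernelize (vs, es, k) = (if k \<le> length P then ([], [], 0)
      else (filter (kept P M) vs, kept_edges P M es, k))"
    by (simp add: kernelize_def P_def M_def Let_def)
  show "distinct vs'" "distinct (map (\<lambda>(u, v). {u, v}) es')" "k' \<le> k"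
    using out vs es
    by (auto simp: kernelize kept_edges_def distinct_map_filter split: if_splits)
  then have card: "length vs' = card (set vs')"
    by (simp add: distinct_card)
  show "length vs' \<le> 7 * k"
  proof (cases "k \<le> length P")
    case False
    then have "set vs' = {x \<in> set vs. kept P M x}" using out by (auto simp: kernelize)
    with False card_kept card show ?thesis by simp
  qed (use out in \<open>auto simp: kernelize\<close>)
  show "finite_simple_graph (list_graph vs' es')"
  proof -
    have "u \<noteq> v \<and> u \<in> set vs' \<and> v \<in> set vs'" if "(u, v) \<in> set es'" for u v
      using that out edge_in[of u v] by (auto simp: kernelize kept_edges_def split: if_splits)
    then show ?thesis
      by (fastforce simp: finite_simple_graph_def list_graph_def)
  qed
  show "P2_packing (list_graph vs es) k \<longleftrightarrow> P2_packing (list_graph vs' es') k'"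
  proof (cases "k \<le> length P")
    case True
    have "P2_packing (list_graph vs es) (length P)"
      using distinct_covered path_in_P path_in_verts
      by (intro P2_packing_covered) (auto simp: is_P2_list_graph)
    then have "P2_packing (list_graph vs es) k"
      using True by (rule P2_packing_mono_number)
    moreover have "P2_packing (list_graph vs' es') 0"
      unfolding P2_packing_def by (intro exI[of _ "{}"]) simp
    ultimately show ?thesis using out True by (auto simp: kernelize)
  next
    case False
    then show ?thesis using out P2_packing_kernel[of k] by (auto simp: kernelize)
  qed
qed


section \<open>The kernel is computable in polynomial time\<close>

lemma poly_time_imp [poly_time_intros]:
  assumes "poly_time f" "poly_time g"
  shows "poly_time (\<lambda>x. f x \<longrightarrow> g x)"
  by (rule back_subst[of poly_time, OF poly_time_If[OF assms poly_time_const[of True]]]) auto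

lemma poly_time_uncurry3:
  assumes "poly_time (\<lambda>p. h (fst p) (fst (snd p)) (snd (snd p)))"
    "poly_time f" "poly_time g" "poly_time k"
  shows "poly_time (\<lambda>x. h (f x) (g x) (k x))"
  using poly_time_comp[OF poly_time_Pair[OF assms(2) poly_time_Pair[OF assms(3,4)]] assms(1)] by simp

lemma poly_time_adj [poly_time_intros]:
  assumes "poly_time es" "poly_time u" "poly_time v"
  shows "poly_time (\<lambda>x. adj (es x) (u x) (v x))"
  unfolding adj_def by (intro poly_time_intros assms)

lemma poly_time_path_list [poly_time_intros]:
  assumes "poly_time p"
  shows "poly_time (\<lambda>x. path_list (p x))"
  unfolding path_list_def by (intro poly_time_intros assms)

lemma poly_time_covered [poly_time_intros]:
  assumes "poly_time P"
  shows "poly_time (\<lambda>x. covered (P x))"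
  unfolding covered_def by (intro poly_time_intros assms)

lemma poly_time_path_in [poly_time_intros]:
  assumes "poly_time es" "poly_time p"
  shows "poly_time (\<lambda>x. path_in (es x) (p x))"
  unfolding path_in_def by (intro poly_time_intros assms)

lemma poly_time_packing_in [poly_time_intros]:
  assumes "poly_time es" "poly_time P"
  shows "poly_time (\<lambda>x. packing_in (es x) (P x))"
  unfolding packing_in_def by (intro poly_time_intros assms assms[THEN poly_time_comp[rotated]])

lemma poly_time_free_edges [poly_time_intros]:
  assumes "poly_time es" "poly_time P"
  shows "poly_time (\<lambda>x. free_edges (es x) (P x))"
  unfolding free_edges_def by (intro poly_time_intros assms assms[THEN poly_time_comp[rotated]])

lemma poly_time_better [poly_time_intros]:
  assumes "poly_time es" "poly_time Q" "poly_time P"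
  shows "poly_time (\<lambda>x. better (es x) (Q x) (P x))"
  unfolding better_def by (intro poly_time_intros assms)

lemma poly_time_triples [poly_time_intros]:
  assumes "poly_time vs"
  shows "poly_time (\<lambda>x. triples (vs x))"
  unfolding triples_def by (intro poly_time_intros assms)

lemma poly_time_exchanges [poly_time_intros]:
  assumes "poly_time vs" "poly_time P"
  shows "poly_time (\<lambda>x. exchanges (vs x) (P x))"
  unfolding exchanges_def by (intro poly_time_intros assms assms[THEN poly_time_comp[rotated]])

lemma poly_time_improve [poly_time_intros]:
  assumes "poly_time vs" "poly_time es" "poly_time P"
  shows "poly_time (\<lambda>x. improve (vs x) (es x) (P x))"
  unfolding improve_def by (intro poly_time_intros assms assms[THEN poly_time_comp[rotated]])

text \<open>An exchange adds at most two triples of input vertices, so the growth does not depend on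
  the current packing, as the iteration demands. The constant 6 is two triples with two pairing
  nodes and one list node each.\<close>

lemma size_code_improve:
  "size (code (improve vs es P)) \<le> size (code P) + 6 * size (code vs) + 6"
proof -
  have triple: "size (code A) \<le> 3 * size (code vs) + 2" if "A \<in> set (triples vs)" for A
  proof -
    obtain u v w where A: "A = (u, v, w)" by (cases A)
    with that have "u \<in> set vs" "v \<in> set vs" "w \<in> set vs" by (auto simp: triples_iff)
    from this[THEN size_code_member] show ?thesis by (simp add: A)
  qed
  have exchange: "size (code Q) \<le> size (code P) + 6 * size (code vs) + 6"
    if "Q \<in> set (exchanges vs P)" for Q
  proof -
    from that obtain A B L where "A \<in> set (triples vs)" "B \<in> set (triples vs)"
      "Q = A # filter (\<lambda>p. p \<noteq> L) P \<or> Q = A # B # filter (\<lambda>p. p \<noteq> L) P"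
      unfolding exchanges_iff by blast
    then show ?thesis
      using triple[of A] triple[of B] size_code_filter[of "\<lambda>p. p \<noteq> L" P] by auto
  qed
  from pick_cases[of "\<lambda>Q. better es Q P" "exchanges vs P" P] show ?thesis
    unfolding improve_def using exchange by auto
qed

lemma poly_time_local_packing [poly_time_intros]:
  assumes "poly_time vs" "poly_time es"
  shows "poly_time (\<lambda>x. local_packing (vs x) (es x))"
proof (rule poly_time_uncurry[OF _ assms])
  show "poly_time (\<lambda>p. local_packing (fst p) (snd p))"
    unfolding local_packing_def
  proof (rule poly_time_fold_additive[where b = "[:6, 6:]"])
    show "size (code (improve (fst x) (snd x) r)) \<le>
        size (code r) + poly [:6, 6:] (size (code x) + size (code a))" for x r and a :: "nat \<times> nat \<times> nat"
      using size_code_improve[of "fst x" "snd x" r] size_code_fst[of x] by simp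
  qed (intro poly_time_intros)+
qed

lemma poly_time_isolated_list [poly_time_intros]:
  assumes "poly_time vs" "poly_time es" "poly_time P"
  shows "poly_time (\<lambda>x. isolated_list (vs x) (es x) (P x))"
  unfolding isolated_list_def by (intro poly_time_intros assms assms[THEN poly_time_comp[rotated]])

lemma poly_time_crown_items [poly_time_intros]:
  assumes "poly_time vs" "poly_time es" "poly_time P"
  shows "poly_time (\<lambda>x. crown_items (vs x) (es x) (P x))"
  unfolding crown_items_def by (intro poly_time_intros assms)

lemma poly_time_crown_slots [poly_time_intros]:
  assumes "poly_time P"
  shows "poly_time (\<lambda>x. crown_slots (P x))"
  unfolding crown_slots_def by (intro poly_time_intros assms)

lemma poly_time_compatible [poly_time_intros]:
  assumes "poly_time es" "poly_time i" "poly_time s"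
  shows "poly_time (\<lambda>x. compatible (es x) (i x) (s x))"
  unfolding compatible_def by (intro poly_time_intros assms)

lemma poly_time_may_bid [poly_time_intros]:
  assumes "poly_time es" "poly_time slots" "poly_time st" "poly_time b"
  shows "poly_time (\<lambda>x. may_bid (compatible (es x)) (slots x) (st x) (b x))"
  unfolding may_bid_def by (intro poly_time_intros assms assms[THEN poly_time_comp[rotated]])

lemma poly_time_place_bid [poly_time_intros]:
  assumes "poly_time st" "poly_time b"
  shows "poly_time (\<lambda>x. place_bid (st x) (b x))"
  unfolding place_bid_def by (intro poly_time_intros assms assms[THEN poly_time_comp[rotated]])

lemma size_code_place_bid:
  "size (code (place_bid st b)) \<le> size (code st) + 2 * size (code b) + 2"
proof -
  have "size (code (filter (\<lambda>c. snd c \<noteq> snd b) (fst st))) + size (code (snd st)) < size (code st)"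
    using size_code_filter[of "\<lambda>c. snd c \<noteq> snd b" "fst st"] by (simp add: code_prod_def)
  then show ?thesis
    using size_code_snd[of b] by (simp add: place_bid_def)
qed

lemma poly_time_auction_step:
  "poly_time (\<lambda>p. auction_step (compatible (fst (fst p))) (fst (snd (fst p))) (snd (snd (fst p))) (snd p))"
  unfolding auction_step_def
proof (rule poly_time_fold_additive[where b = "[:2, 2:]"])
  show "size (code (place_bid (snd x) b)) \<le>
      size (code r) + poly [:2, 2:] (size (code x) + size (code b))" for x and b and r
    using size_code_place_bid[of "snd x" b] size_code_snd[of x] by simp
qed (intro poly_time_intros)+

text \<open>Although a step tests all pairs, it places only one bid, so the state grows by an
  additive amount.\<close>

lemma size_code_auction_step:
  "size (code (auction_step E items slots st)) \<le>
    size (code st) + 2 * (size (code items) + size (code slots) + 1) + 2"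
proof -
  have "size (code (place_bid st (i, s))) \<le>
      size (code st) + 2 * (size (code items) + size (code slots) + 1) + 2"
    if "i \<in> set items" "s \<in> set slots" for i s
    using that[THEN size_code_member] size_code_place_bid[of st "(i, s)"] by simp
  with auction_step_cases[of E items slots st] show ?thesis by auto
qed

lemma poly_time_kernel_matching [poly_time_intros]:
  assumes "poly_time vs" "poly_time es" "poly_time P"
  shows "poly_time (\<lambda>x. kernel_matching (vs x) (es x) (P x))"
proof -
  have "poly_time (\<lambda>p. auction (compatible (fst p)) (fst (snd p)) (snd (snd p)) (0, 0))"
    unfolding auction_def
  proof (rule poly_time_fst, rule poly_time_fold_additive[where b = "[:4, 4:]"])
    show "size (code (auction_step (compatible (fst x)) (fst (snd x)) (snd (snd x)) r)) \<le>
        size (code r) + poly [:4, 4:] (size (code x) + size (code a))" for x r and a :: "'z::coded"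
      using size_code_auction_step[of "compatible (fst x)" "fst (snd x)" "snd (snd x)" r]
      by (auto simp: code_prod_def)
    show "poly_time (\<lambda>p. auction_step (compatible (fst (fst p))) (fst (snd (fst p)))
        (snd (snd (fst p))) (snd (snd p)))"
      using poly_time_uncurry[OF poly_time_auction_step, of fst "\<lambda>p. snd (snd p)"]
      by (simp add: poly_time_intros)
  qed (intro poly_time_intros)+
  then show ?thesis
    unfolding kernel_matching_def by (rule poly_time_uncurry3) (intro poly_time_intros assms)+
qed

lemma poly_time_kept [poly_time_intros]:
  assumes "poly_time P" "poly_time M" "poly_time y"
  shows "poly_time (\<lambda>x. kept (P x) (M x) (y x))"
  unfolding kept_def by (intro poly_time_intros assms assms[THEN poly_time_comp[rotated]])

lemma poly_time_kept_edges [poly_time_intros]: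
  assumes "poly_time P" "poly_time M" "poly_time es"
  shows "poly_time (\<lambda>x. kept_edges (P x) (M x) (es x))"
  unfolding kept_edges_def by (intro poly_time_intros assms assms[THEN poly_time_comp[rotated]])

lemma poly_time_kernelize: "poly_time kernelize"
  unfolding kernelize_def case_prod_unfold Let_def by (intro poly_time_intros)

text \<open>The expression becomes the body of function 0 and its library moves one place back; the
  initial call and its argument cost two more steps.\<close>

lemma poly_time_runs:
  assumes "poly_time f"
  obtains p q where "\<And>x. \<exists>t. runs p (code x) (code (f x)) t \<and>
    t + size (code (f x)) \<le> poly q (size (code x))"
proof -
  obtain p e q where "computes p e q f"
    using assms unfolding poly_time_def by blast
  define p' where "p' = shift_calls 1 e # map (shift_calls 1) p"
  have c: "computes p' (shift_calls 1 e) q f"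
    using computes_shift_calls[OF \<open>computes p e q f\<close>, of "[shift_calls 1 e]"] by (simp add: p'_def)
  have "\<exists>t. runs p' (code x) (code (f x)) t \<and>
      t + size (code (f x)) \<le> poly (q + 2) (size (code x))" for x
  proof -
    obtain t where t: "evaluates p' [code x] (shift_calls 1 e) (code (f x)) t"
      "t + size (code (f x)) \<le> poly q (size (code x))"
      using c by (rule computesE)
    have "evaluates_list p' [code x] [Var 0] [code x] (1 + 0)"
      by (intro evaluates_evaluates_list.Cons evaluates_evaluates_list.Nil evaluates_Var0)
    from evaluates_Call_0[OF this[unfolded p'_def] t(1)[unfolded p'_def]]
    have "runs p' (code x) (code (f x)) (Suc (1 + 0 + t))"
      unfolding runs_def p'_def .
    with t(2) show ?thesis by (intro exI conjI) auto
  qed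
  with that show thesis by blast
qed

text \<open>The generic code of a triple agrees with the encoding of instances, which carries the
  time bound over to the problem.\<close>

lemma code_instance: "code (vs, es, k) =
    Branch (list_code nat_code vs) (Branch (list_code edge_code es) (nat_code k))"
proof -
  have "edge_code = code" by (rule ext) (auto simp: edge_code_def code_nat_def)
  then show ?thesis by (simp add: code_list_def code_nat_def)
qed

lemma encodes_iff: "encodes x G k \<longleftrightarrow> (\<exists>vs es. distinct vs \<and>
    distinct (map (\<lambda>(u, v). {u, v}) es) \<and> G = list_graph vs es \<and> x = code (vs, es, k))"
  unfolding encodes_def list_graph_def code_instance prod_eq_iff fst_conv snd_conv by metis

theorem theorem3:
  shows "admits_kernel P2_packing (\<lambda>k. 7 * k)"
proof -
  obtain p q where p: "\<And>x. \<exists>t. runs p (code x) (code (kernelize x)) t \<and>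
      t + size (code (kernelize x)) \<le> poly q (size (code x))"
    using poly_time_runs[OF poly_time_kernelize] by metis
  have "is_kernel P2_packing (\<lambda>k. 7 * k) p"
    unfolding is_kernel_def
  proof (intro conjI allI impI)
    show "poly_time_on instance_codes p"
      unfolding poly_time_on_def
    proof (rule exI[of _ q], intro ballI)
      fix x assume "x \<in> instance_codes"
      then obtain vs es k where "x = code (vs :: nat list, es :: (nat \<times> nat) list, k :: nat)"
        by (auto simp: instance_codes_def encodes_iff)
      then show "\<exists>y t. runs p x y t \<and> t + size y \<le> poly q (size x)"
        using p by blast
    qed
    fix G k x y t
    assume "finite_simple_graph G \<and> encodes x G k \<and> runs p x y t"
    then obtain vs es where G: "finite_simple_graph (list_graph vs es)" "distinct vs"
        "distinct (map (\<lambda>(u, v). {u, v}) es)" "G = list_graph vs es"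
      and x: "x = code (vs, es, k)" and r: "runs p x y t"
      by (auto simp: encodes_iff)
    obtain vs' es' k' where out: "kernelize (vs, es, k) = (vs', es', k')"
      by (metis prod.exhaust)
    \<comment> \<open>Evaluation is deterministic, so the given run on \<open>x\<close> is the one
      known to output the kernel.\<close>
    from p[of "(vs, es, k)"] r have y: "y = code (vs', es', k')"
      unfolding x runs_def out using evaluates_deterministic(1) by blast
    note K = kernelize_correct[OF G(1-3) out]
    have "encodes y (list_graph vs' es') k'"
      unfolding encodes_iff y using K(2,3) by blast
    moreover have "card (verts (list_graph vs' es')) \<le> 7 * k"
      using K(5) card_length[of vs'] by (simp add: list_graph_def)
    ultimately show "\<exists>G' k'. finite_simple_graph G' \<and> encodes y G' k' \<and>
        (P2_packing G k \<longleftrightarrow> P2_packing G' k') \<and> k' \<le> k \<and> card (verts G') \<le> 7 * k"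
      using K(1,4,6) G(4) by blast
  qed
  then show ?thesis
    unfolding admits_kernel_def by blast
qed

end
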